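(* Let $d,k,p\in\mathbb{N}$ and let $I\subset\mathbb{R}$ be a nondegenerate compact interval. Let $(\xi_n)_{n\in\mathbb{N}}$ be a sequence of independent and identically distributed $d$-dimensional discrete random variables on a probability space $(\Omega,\mathcal{A},\mathbb{P})$ having finite range $\{a_1,\ldots,a_k\}$, where $a_1,\ldots,a_k\in\mathbb{R}^d$ are pairwise distinct. Let $q_i:=\mathbb{P}(\xi_1=a_i)\in(0,1)$, $i=1,\ldots,k$. Let $m_i\in\mathcal{M}_p$, $i=1,\ldots,k$, and for each $n\in\mathbb{N}$ let $M_n:\Omega\to\mathcal{M}_p$, $$(M_n(\omega))(x_1,\ldots,x_p):=\sum_{i=1}^k m_i(x_1,\ldots,x_p)\,\mathbf{1}_{\{\xi_n(\omega)=a_i\}},\qquad \omega\in\Omega,\ x_1,\ldots,x_p\in I.$$ Then for each $n\in\mathbb{N}$, $M_n$ is a random mean generated by $\xi_n$, and $$\mathbb{P}\Big(\big\{\omega\in\Omega:\lim_{n\to\infty}\kappa_n(\omega)=0\big\}\Big)=1,$$ where $$\kappa_n(\omega):=\sup_{x\in I^p}\Big|\frac1n\sum_{j=1}^n (M_j(\omega))(x)-(\mathbb{E}(M_1))(x)\Big|,\qquad \omega\in\Omega,$$ with $(\mathbb{E}(M_1))(x_1,\ldots,x_p)=\sum_{i=1}^k m_i(x_1,\ldots,x_p)\,\mathbb{P}(\xi_1=a_i)$ for $x_1,\ldots,x_p\in I$. Further, as $n\to\infty$, $$\sqrt n\,\kappa_n\ \stackrel{\mathcal{D}}{\longrightarrow}\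 \sup_{x_1,\ldots,x_p\in I}\big|\langle \mathcal{N}_k(\mathbf{0},\mathbf{Q}),\mathbf{m}(x_1,\ldots,x_p)\rangle\big|,$$ where $\mathbf{Q}=(q_{i,j})_{i,j=1}^k\in\mathbb{R}^{k\times k}$ is the matrix with $q_{i,j}=q_i(1-q_i)$ if $i=j$ and $q_{i,j}=-q_iq_j$ if $i\neq j$, and $\mathbf{m}(x_1,\ldots,x_p):=(m_1(x_1,\ldots,x_p),\ldots,m_k(x_1,\ldots,x_p))^\top\in\mathbb{R}^k$.
   Context: $\mathbb{N}$ is the set of positive integers. A nondegenerate interval is one containing at least two distinct points. $\mathcal{B}(\cdot)$ denotes the Borel $\sigma$-algebra. $\mathcal{C}(I^p)$ is the Banach space of real-valued continuous functions on $I^p$ with the supremum norm. $\langle\cdot,\cdot\rangle$ is the Euclidean inner product, $\stackrel{\mathcal{D}}{\longrightarrow}$ denotes convergence in distribution, and $\mathcal{N}_k(\mathbf{0},\mathbf{Q})$ in the limit denotes a random vector having the (possibly degenerate) $k$-dimensional normal distribution with mean vector $\mathbf{0}$ and covariance matrix $\mathbf{Q}$. $\mathcal{M}_p\subset\mathcal{C}(I^p)$ is the set of $p$-variable (continuous) means on $I$: those $m\in\mathcal{C}(I^p)$ with $\min(x)\le m(x)\le\max(x)$ for all $x\in I^p$, where $\min(x)$ and $\max(x)$ are the minimum and maximum of the coordinates of $x$. Definition (random mean generated by $\xi$). Let $\xi:\Omega\to\mathbb{R}^d$ be a random variable on $(\Omega,\mathcal{A},\mathbb{P})$. A map $M:\Omega\to\mathcal{M}_p$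 is called a ($p$-variable, continuous) random mean (in $I$) generated by $\xi$ if: (i) $M$ is $(\mathcal{A},\mathcal{B}(\mathcal{C}(I^p)))$-measurable; and (ii) there is a $(\mathcal{B}(I^p)\times\mathcal{B}(\mathbb{R}^d),\mathcal{B}(I))$-measurable map $M_\xi:I^p\times\mathbb{R}^d\to I$ such that (a) for every $\omega\in\Omega$ the map $I^p\ni x\mapsto M_\xi(x,\xi(\omega))$ is in $\mathcal{C}(I^p)$, and (b) $\mathbb{P}(\{\omega\in\Omega:(M(\omega))(x)=M_\xi(x,\xi(\omega))\text{ for every }x\in I^p\})=1$. Expected value. For such an $M$, $\mathbb{E}(M):=\int_\Omega M(\omega)\,\mathrm{d}\mathbb{P}(\omega)\in\mathcal{C}(I^p)$ is the Bochner integral of $M$ regarded as a map into $\mathcal{C}(I^p)$. *)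

theory Defs
  imports "HOL-Probability.Probability"
begin

definition cube :: "real set \<Rightarrow> (real ^ 'p) set" where
  "cube I = {x. \<forall>i. x $ i \<in> I}"

(* The carrier consists of the continuous functions on I^p, extended by the value undefined
   outside I^p; the metric is the supremum distance. The boundedness requirement contained in
   cfunspace is automatic for compact I. *)
abbreviation cont_space :: "real set \<Rightarrow> (real ^ 'p \<Rightarrow> real) metric" where
  "cont_space I \<equiv> cfunspace (top_of_set (cube I)) euclidean_metric"

definition borel_cont :: "real set \<Rightarrow> (real ^ 'p \<Rightarrow> real) measure" where
  "borel_cont I = sigma (mspace (cont_space I)) {U. openin (mtopology_of (cont_space I)) U}"

definition means :: "real set \<Rightarrow> (real ^ 'p \<Rightarrow> real) set" where
  "means I = {m \<in> mspace (cont_space I).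
     \<forall>x\<in>cube I. Min (range (($) x)) \<le> m x \<and> m x \<le> Max (range (($) x))}"

definition random_mean ::
    "'a measure \<Rightarrow> real set \<Rightarrow> ('a \<Rightarrow> real ^ 'd) \<Rightarrow> ('a \<Rightarrow> real ^ 'p \<Rightarrow> real) \<Rightarrow> bool" where
  "random_mean P I \<xi> M \<longleftrightarrow>
     \<xi> \<in> P \<rightarrow>\<^sub>M borel \<and>
     (\<forall>\<omega>\<in>space P. M \<omega> \<in> means I) \<and>
     M \<in> P \<rightarrow>\<^sub>M borel_cont I \<and>
     (\<exists>F \<in> restrict_space borel (cube I) \<Otimes>\<^sub>M borel \<rightarrow>\<^sub>M restrict_space borel I.
        (\<forall>\<omega>\<in>space P. (\<lambda>x\<in>cube I. F (x, \<xi> \<omega>)) \<in> mspace (cont_space I)) \<and>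
        measure P {\<omega>\<in>space P. \<forall>x\<in>cube I. M \<omega> x = F (x, \<xi> \<omega>)} = 1)"

(* The Bochner integral of the library requires a second countable normed vector space as a type,
   whereas C(I^p) depends on the term I. The following definitions repeat the library's definition
   of has_bochner_integral for the target C(I^p) and a finite measure P (so that every simple
   function is integrable). *)
definition simple_integral_cont ::
    "'a measure \<Rightarrow> real set \<Rightarrow> ('a \<Rightarrow> real ^ 'p \<Rightarrow> real) \<Rightarrow> real ^ 'p \<Rightarrow> real" where
  "simple_integral_cont P I s =
     (\<lambda>x\<in>cube I. \<Sum>h\<in>s ` space P. measure P {\<omega>\<in>space P. s \<omega> = h} * h x)"

definition has_expectation_cont ::
    "'a measure \<Rightarrow> real set \<Rightarrow> ('a \<Rightarrow> real ^ 'p \<Rightarrow> real) \<Rightarrow> (real ^ 'p \<Rightarrow> real) \<Rightarrow> bool" where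
  "has_expectation_cont P I M e \<longleftrightarrow>
     M \<in> P \<rightarrow>\<^sub>M borel_cont I \<and>
     (\<exists>s. (\<forall>n. simple_function P (s n) \<and> s n \<in> space P \<rightarrow> mspace (cont_space I)) \<and>
          (\<lambda>n. \<integral>\<^sup>+\<omega>. ennreal (mdist (cont_space I) (M \<omega>) (s n \<omega>)) \<partial>P) \<longlonglongrightarrow> 0 \<and>
          limitin (mtopology_of (cont_space I)) (\<lambda>n. simple_integral_cont P I (s n)) e sequentially)"

definition expectation_cont ::
    "'a measure \<Rightarrow> real set \<Rightarrow> ('a \<Rightarrow> real ^ 'p \<Rightarrow> real) \<Rightarrow> real ^ 'p \<Rightarrow> real" where
  "expectation_cont P I M = (THE e. has_expectation_cont P I M e)"

(* The normal law with mean mu and covariance matrix Q, possibly degenerate: the law of mu + A G,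
   where A A^T = Q and G has independent standard normal coordinates. It does not depend on the
   choice of A; see char_multi_normal below. Meaningful only for Q symmetric positive semidefinite,
   i.e. if such an A exists. *)
definition multi_normal :: "real ^ 'k \<Rightarrow> real ^ 'k ^ 'k \<Rightarrow> (real ^ 'k) measure" where
  "multi_normal \<mu> Q =
     (let A = (SOME A :: real ^ 'k ^ 'k. A ** transpose A = Q) in
      distr (\<Pi>\<^sub>M i\<in>UNIV. std_normal_distribution) borel (\<lambda>g. \<mu> + A *v (\<chi> i. g i)))"

lemma char_multi_normal:
  fixes \<mu> t :: "real ^ 'k" and Q :: "real ^ 'k ^ 'k"
  assumes "\<exists>A :: real ^ 'k ^ 'k. A ** transpose A = Q"
  shows "char (distr (multi_normal \<mu> Q) borel (\<lambda>z. t \<bullet> z)) u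
    = exp (\<i> * of_real (u * (t \<bullet> \<mu>)) - of_real (u\<^sup>2 * (t \<bullet> (Q *v t)) / 2))"
proof -
  define A :: "real ^ 'k ^ 'k" where "A = (SOME A. A ** transpose A = Q)"
  have A: "A ** transpose A = Q"
    unfolding A_def using assms by (rule someI_ex)
  define c where "c = transpose A *v t"
  interpret product_sigma_finite "\<lambda>_::'k. std_normal_distribution"
    by unfold_locales (metis prob_space_normal_density prob_space.finite_measure
        finite_measure.finite_emeasure_space zero_less_one sigma_finite_measure.sigma_finite_countable
        finite_measure.axioms(1))
  have adj: "t \<bullet> (A *v w) = c \<bullet> w" for w
    by (simp add: c_def dot_lmul_matrix)
  have tQ: "t \<bullet> (Q *v t) = (\<Sum>j\<in>UNIV. (c $ j)\<^sup>2)"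
    unfolding A[symmetric] matrix_vector_mul_assoc[symmetric] adj
    unfolding c_def[symmetric] by (simp add: inner_vec_def power2_eq_square)
  have tA: "t \<bullet> (\<mu> + A *v (\<chi> i. g i)) = t \<bullet> \<mu> + (\<Sum>j\<in>UNIV. c $ j * g j)" for g
    by (simp only: inner_add_right adj) (simp add: inner_vec_def)
  have [measurable]: "(\<lambda>g. \<mu> + A *v (\<chi> i. g i)) \<in> (\<Pi>\<^sub>M i\<in>UNIV. std_normal_distribution) \<rightarrow>\<^sub>M borel"
    by (subst borel_measurable_euclidean_space)
      (auto simp: Basis_vec_def inner_axis matrix_vector_mult_def intro!: measurable_component_singleton)
  have int: "integrable std_normal_distribution (\<lambda>x. iexp (u * c $ j * x))" for j
    using prob_space_normal_density[of 1 0]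
    by (intro prob_space.integrable_iexp) auto
  have "char (distr (multi_normal \<mu> Q) borel (\<lambda>z. t \<bullet> z)) u
      = (CLINT g|(\<Pi>\<^sub>M i\<in>UNIV. std_normal_distribution). iexp (u * (t \<bullet> (\<mu> + A *v (\<chi> i. g i)))))"
    unfolding char_def multi_normal_def A_def[symmetric] Let_def
    by (simp add: integral_distr)
  also have "\<dots> = (CLINT g|(\<Pi>\<^sub>M i\<in>UNIV. std_normal_distribution).
      iexp (u * (t \<bullet> \<mu>)) * (\<Prod>j\<in>UNIV. iexp (u * c $ j * g j)))"
    by (intro Bochner_Integration.integral_cong refl)
      (simp only: tA, simp add: exp_add[symmetric] exp_sum[symmetric] algebra_simps sum_distrib_left)
  also have "\<dots> = iexp (u * (t \<bullet> \<mu>)) * (\<Prod>j\<in>UNIV. char std_normal_distribution (u * c $ j))"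
    unfolding char_def
    by (subst integral_mult_right_zero, subst product_integral_prod) (simp_all only: finite int refl)
  also have "\<dots> = exp (\<i> * of_real (u * (t \<bullet> \<mu>)) - of_real (u\<^sup>2 * (t \<bullet> (Q *v t)) / 2))"
  proof -
    have "(\<Prod>j\<in>UNIV. exp (- ((u * c $ j)\<^sup>2) / 2)) = exp (- (u\<^sup>2 * (t \<bullet> (Q *v t)) / 2))"
      by (simp add: tQ exp_sum[symmetric] sum_negf sum_divide_distrib power_mult_distrib
          sum_distrib_left)
    then show ?thesis
      unfolding char_std_normal_distribution of_real_prod[symmetric]
      by (simp only: diff_conv_add_uminus exp_add of_real_minus[symmetric] exp_of_real)
  qed
  finally show ?thesis .
qed

end

theory Submission
  imports Defs
begin

text \<open>
  With \<open>W\<^sub>n\<close> the vector of the deviations of the empirical frequencies of \<open>a\<^sub>1, \<dots>, a\<^sub>k\<close> from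
  \<open>q\<^sub>1, \<dots>, q\<^sub>k\<close>, one has \<open>\<kappa>\<^sub>n = \<psi> W\<^sub>n\<close> for the seminorm \<open>\<psi> z = sup\<^sub>x \<bar>z \<bullet> m x\<bar>\<close>, which is continuous since
  \<open>m\<close> is bounded. So the law of large numbers reduces to that for the frequencies (Hoeffding and
  Borel-Cantelli), and the limit law to the multivariate central limit theorem
  for \<open>sqrt n W\<^sub>n\<close>: the one-dimensional theorem gives convergence of the characteristic
  functions, Hoeffding's bound gives tightness, and tightness lets one approximate bounded
  continuous functions by trigonometric polynomials.
\<close>

subsection \<open>Weak convergence from characteristic functions\<close>

text \<open>The matrix \<open>Q\<close> is always singular: the frequencies sum to one, so the
  coordinates of the deviation vector sum to zero for \<open>n \<ge> 1\<close>, and \<open>Q\<close>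
  annihilates the vector of ones. This shapes two steps. The limit law is defined through a factor
  \<open>A\<close> with \<open>A ** transpose A = Q\<close>, so such a factor must be exhibited
  although \<open>Q\<close> is not invertible. And the one-dimensional central limit theorem
  requires positive variance, so directions in which the projected variable is almost surely
  constant are treated apart. Weak convergence of random vectors is never stated: the limit concerns
  the real variable \<open>\<psi>\<close> of a vector, and only integrals of bounded continuous
  functions of the vector are compared. Hoeffding's bound is used at two scales: at a fixed distance
  it is summable in \<open>n\<close>, and at a distance of order \<open>1 / sqrt n\<close> it no
  longer depends on \<open>n\<close>. For the expected value, each random mean takes finitely many
  values, so its integral is a finite sum; the work lies in showing that no other approximating
  sequence leads to a different value.\<close>

inductive trig_poly :: "('a::euclidean_space \<Rightarrow> complex) \<Rightarrow> bool" where
  monomial: "trig_poly (\<lambda>x. c * iexp (t \<bullet> x))"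
| add: "trig_poly f \<Longrightarrow> trig_poly g \<Longrightarrow> trig_poly (\<lambda>x. f x + g x)"

lemma trig_poly_const: "trig_poly (\<lambda>x. c)"
  using trig_poly.monomial[of c 0] by simp

text \<open>Multiplying exponentials adds their frequencies, so trigonometric polynomials form an
  algebra; hence polynomials in sines remain among them.\<close>

lemma trig_poly_mult:
  assumes "trig_poly f" "trig_poly g"
  shows "trig_poly (\<lambda>x. f x * g x)"
  using assms
proof (induction f rule: trig_poly.induct)
  case (monomial c t)
  from monomial show ?case
  proof (induction g rule: trig_poly.induct)
    case (monomial d s)
    have "(\<lambda>x. (c * iexp (t \<bullet> x)) * (d * iexp (s \<bullet> x))) = (\<lambda>x. (c * d) * iexp ((t + s) \<bullet> x))"
      by (simp add: inner_add_left exp_add algebra_simps)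
    then show ?case
      by (simp only: trig_poly.monomial)
  next
    case (add f g)
    then show ?case
      by (simp add: distrib_left trig_poly.add)
  qed
next
  case (add f h)
  then show ?case
    by (simp add: distrib_right trig_poly.add)
qed

lemma trig_poly_sum:
  assumes "finite A" "\<And>i. i \<in> A \<Longrightarrow> trig_poly (f i)"
  shows "trig_poly (\<lambda>x. \<Sum>i\<in>A. f i x)"
  using assms by (induction A rule: finite_induct) (auto intro: trig_poly_const trig_poly.add)

lemma trig_poly_sin: "trig_poly (\<lambda>x. of_real (sin (t \<bullet> x)))"
proof -
  have "(\<lambda>x. of_real (sin (t \<bullet> x))) =
      (\<lambda>x. (- \<i> / 2) * iexp (t \<bullet> x) + (\<i> / 2) * iexp ((- t) \<bullet> x))"
    by (rule ext, rule complex_eqI) (simp_all add: Re_exp Im_exp)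
  then show ?thesis
    by (simp only: trig_poly.intros)
qed

text \<open>The factor \<open>r\<close> sits inside the inner product so that each coordinate has
  the form \<open>sin (t \<bullet> x)\<close> with frequency
  \<open>t = r *\<^sub>R b\<close>.\<close>

definition sin_map :: "real \<Rightarrow> 'a::euclidean_space \<Rightarrow> 'a" where
  "sin_map r x = (\<Sum>b\<in>Basis. sin ((r *\<^sub>R b) \<bullet> x) *\<^sub>R b)"

lemma trig_poly_compose_sin_map:
  assumes "real_polynomial_function p"
  shows "trig_poly (\<lambda>x. of_real (p (sin_map r x)))"
  using assms
proof (induction p rule: real_polynomial_function.induct)
  case (linear f)
  interpret bounded_linear f by fact
  have "(\<lambda>x. complex_of_real (f (sin_map r x))) =
      (\<lambda>x. \<Sum>b\<in>Basis. of_real (f b) * of_real (sin ((r *\<^sub>R b) \<bullet> x)))"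
    by (simp add: sin_map_def sum scale mult.commute)
  then show ?case
    by (auto intro!: trig_poly_sum trig_poly_mult trig_poly_const trig_poly_sin
        simp del: inner_scaleR_left)
next
  case (const c)
  show ?case by (rule trig_poly_const)
next
  case (add f g)
  then show ?case by (simp add: trig_poly.add)
next
  case (mult f g)
  then show ?case by (simp add: trig_poly_mult)
qed

section \<open>Integrals of trigonometric polynomials and mass of tails\<close>

lemma trig_poly_integrable:
  assumes "trig_poly g" "finite_measure \<mu>" "sets \<mu> = sets borel"
  shows "integrable \<mu> g"
  using assms
proof (induction g rule: trig_poly.induct)
  case (monomial c t)
  then interpret finite_measure \<mu> by simp
  have "(\<lambda>x. iexp (t \<bullet> x)) \<in> borel_measurable \<mu>"
    unfolding measurable_cong_sets[OF monomial(2) refl] by measurable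
  then have "integrable \<mu> (\<lambda>x. iexp (t \<bullet> x))"
    by (intro integrable_const_bound[where B=1]) auto
  then show ?case by simp
qed auto

lemma trig_poly_integral_tendsto:
  fixes \<mu> :: "nat \<Rightarrow> 'a::euclidean_space measure"
  assumes "trig_poly g"
    and "\<And>n. finite_measure (\<mu> n)" "\<And>n. sets (\<mu> n) = sets borel"
    and "finite_measure \<nu>" "sets \<nu> = sets borel"
    and "\<And>t. (\<lambda>n. CLINT x|\<mu> n. iexp (t \<bullet> x)) \<longlonglongrightarrow> (CLINT x|\<nu>. iexp (t \<bullet> x))"
  shows "(\<lambda>n. CLINT x|\<mu> n. g x) \<longlonglongrightarrow> (CLINT x|\<nu>. g x)"
  using assms(1)
proof (induction g rule: trig_poly.induct)
  case (monomial c t)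
  show ?case
    using assms(6)[of t] by (simp add: tendsto_mult_left)
next
  case (add f g)
  have "integrable (\<mu> n) f" "integrable (\<mu> n) g" "integrable \<nu> f" "integrable \<nu> g" for n
    by (intro trig_poly_integrable add assms)+
  with add show ?case
    by (simp add: tendsto_add)
qed

text \<open>Continuity from above along sets decreasing to the empty set. It supplies for the limit
  law the tail bound that tightness supplies for the sequence.\<close>

lemma measure_norm_tail_tendsto_zero:
  fixes \<nu> :: "'a::real_normed_vector measure"
  assumes "finite_measure \<nu>" "sets \<nu> = sets borel"
  shows "(\<lambda>n. measure \<nu> {x. real n < norm x}) \<longlonglongrightarrow> 0"
proof -
  interpret finite_measure \<nu> by fact
  have "(\<lambda>n. measure \<nu> {x. real n < norm x}) \<longlonglongrightarrow> measure \<nu> (\<Inter>n. {x. real n < norm x})"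
    by (intro finite_Lim_measure_decseq)
      (auto simp: assms decseq_def intro!: borel_open open_Collect_less continuous_intros)
  moreover have "(\<Inter>n. {x::'a. real n < norm x}) = {}"
    by (auto simp: set_eq_iff not_less intro: real_arch_simple)
  ultimately show ?thesis
    by simp
qed

text \<open>
  A bounded continuous function is replaced on a large ball by a continuous function of
  \<open>sin (x\<^sub>i / L)\<close>. Since the sines take all values in \<open>[-1, 1]\<close>, approximating
  that function by a polynomial on the cube gives a trigonometric polynomial that is close to it on
  the whole space, so no control of the approximant outside the ball is needed.
\<close>
lemma trig_poly_approximation:
  fixes f :: "'a::euclidean_space \<Rightarrow> real"
  assumes "continuous_on UNIV f" "\<And>x. \<bar>f x\<bar> \<le> B" "0 < e"
  obtains g where "trig_poly (\<lambda>x. of_real (g x))"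
    "\<And>x. norm x \<le> L \<Longrightarrow> \<bar>f x - g x\<bar> \<le> e" "\<And>x. \<bar>g x\<bar> \<le> B + e"
proof -
  \<comment> \<open>The lower bound 1 keeps the scale positive whatever \<open>L\<close> is.\<close>
  define K where "K = max L 1"
  have K: "K > 0" "L \<le> K" by (auto simp: K_def)
  \<comment> \<open>\<open>h\<close> undoes the coordinatewise map \<open>sin (x / K)\<close> before
    applying \<open>f\<close>; it is continuous on the cube because \<open>arcsin\<close> is
    continuous on \<open>[-1, 1]\<close>.\<close>
  define h where "h y = f (\<Sum>b\<in>Basis. (K * arcsin (y \<bullet> b)) *\<^sub>R b)" for y :: 'a
  have "continuous_on (cbox (- One) One) h"
    unfolding h_def
    by (rule continuous_on_compose2[OF assms(1)])
      (auto intro!: continuous_intros simp: mem_box)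
  then obtain p where p: "real_polynomial_function p"
    "\<And>y. y \<in> cbox (- One) One \<Longrightarrow> \<bar>h y - p y\<bar> < e"
    using Stone_Weierstrass_real_polynomial_function[OF compact_cbox _ \<open>0 < e\<close>] by metis
  define s where "s = (sin_map (1 / K) :: 'a \<Rightarrow> 'a)"
  have s_inner: "s x \<bullet> b = sin (b \<bullet> x / K)" if "b \<in> Basis" for x b
    using that by (simp add: s_def sin_map_def inner_sum_left_Basis)
  have s_box: "s x \<in> cbox (- One) One" for x
    by (auto simp: mem_box s_inner)
  have h_s: "h (s x) = f x" if "norm x \<le> L" for x
  proof -
    have "arcsin (s x \<bullet> b) = b \<bullet> x / K" if b: "b \<in> Basis" for b
    proof -
      have "\<bar>b \<bullet> x\<bar> \<le> K"
        using Basis_le_norm[OF b, of x] \<open>norm x \<le> L\<close> K by (simp add: inner_commute)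
      then have "\<bar>b \<bullet> x / K\<bar> \<le> 1" using K by (simp add: divide_le_eq)
      \<comment> \<open>On the ball the scaled coordinates have modulus at most 1, which is less
        than \<open>pi / 2\<close>, so \<open>arcsin\<close> inverts \<open>sin\<close>
        there.\<close>
      then show ?thesis
        using pi_gt3 unfolding s_inner[OF b] by (intro arcsin_sin; linarith)
    qed
    then have "h (s x) = f (\<Sum>b\<in>Basis. (x \<bullet> b) *\<^sub>R b)"
      unfolding h_def using K by (intro arg_cong[where f=f] sum.cong) (auto simp: inner_commute)
    then show ?thesis
      by (simp add: euclidean_representation)
  qed
  show thesis
  proof
    show "trig_poly (\<lambda>x. of_real (p (s x)))"
      unfolding s_def by (rule trig_poly_compose_sin_map[OF p(1)])
    show "\<bar>f x - p (s x)\<bar> \<le> e" if "norm x \<le> L" for x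
      using p(2)[OF s_box, of x] h_s[OF that] by simp
    show "\<bar>p (s x)\<bar> \<le> B + e" for x
      using p(2)[OF s_box, of x] assms(2)[of "\<Sum>b\<in>Basis. (K * arcsin (s x \<bullet> b)) *\<^sub>R b"]
      by (simp add: h_def)
  qed
qed

text \<open>Pointwise the difference is at most \<open>e\<close> plus \<open>C\<close> times the
  indicator of the tail; integrating against a probability measure gives the bound.\<close>

lemma abs_integral_diff_le_tail:
  fixes f g :: "'a::real_normed_vector \<Rightarrow> real"
  assumes "prob_space \<mu>" "sets \<mu> = sets borel"
    and "integrable \<mu> f" "integrable \<mu> g"
    and "\<And>x. norm x \<le> L \<Longrightarrow> \<bar>f x - g x\<bar> \<le> e" "\<And>x. \<bar>f x - g x\<bar> \<le> C" "0 \<le> e"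
  shows "\<bar>(\<integral>x. f x \<partial>\<mu>) - (\<integral>x. g x \<partial>\<mu>)\<bar> \<le> e + C * measure \<mu> {x. L < norm x}"
proof -
  interpret prob_space \<mu> by fact
  have S: "{x. L < norm x} \<in> sets \<mu>"
    by (simp add: assms borel_open open_Collect_less continuous_intros)
  have sp: "space \<mu> = UNIV"
    using sets_eq_imp_space_eq[OF assms(2)] by simp
  have C: "0 \<le> C" using assms(6)[of 0] by linarith
  have "\<bar>(\<integral>x. f x \<partial>\<mu>) - (\<integral>x. g x \<partial>\<mu>)\<bar> = \<bar>\<integral>x. f x - g x \<partial>\<mu>\<bar>"
    using assms by simp
  also have "\<dots> \<le> (\<integral>x. \<bar>f x - g x\<bar> \<partial>\<mu>)"
    by (rule integral_abs_bound)
  also have "\<dots> \<le> (\<integral>x. e + C * indicator {x. L < norm x} x \<partial>\<mu>)"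
  proof (rule integral_mono)
    show "integrable \<mu> (\<lambda>x. e + C * indicator {x. L < norm x} x)"
      using S by (auto intro!: integrable_real_mult_indicator simp: less_top[symmetric])
    show "\<bar>f x - g x\<bar> \<le> e + C * indicator {x. L < norm x} x" for x
      using assms(5)[of x] assms(6)[of x] assms(7) by (auto simp: indicator_def not_less)
  qed (use assms in auto)
  also have "\<dots> = e + C * measure \<mu> {x. L < norm x}"
    using S prob_space by (simp add: sp less_top[symmetric])
  finally show ?thesis .
qed

text \<open>Three-term estimate: \<open>f\<close> is replaced by one trigonometric polynomial
  \<open>g\<close> under every \<open>\<mu> n\<close> and under \<open>\<nu>\<close>, and the
  integrals of \<open>g\<close> converge by the hypothesis on the characteristic functions.\<close>

lemma tight_char_tendsto_imp_integral_tendsto: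
  fixes \<mu> :: "nat \<Rightarrow> 'a::euclidean_space measure" and f :: "'a \<Rightarrow> real"
  assumes prob: "\<And>n. prob_space (\<mu> n)" "prob_space \<nu>"
    and sets: "\<And>n. sets (\<mu> n) = sets borel" "sets \<nu> = sets borel"
    and char: "\<And>t. (\<lambda>n. CLINT x|\<mu> n. iexp (t \<bullet> x)) \<longlonglongrightarrow> (CLINT x|\<nu>. iexp (t \<bullet> x))"
    and tight: "\<And>e. e > 0 \<Longrightarrow> \<exists>L. \<forall>n. measure (\<mu> n) {x. L < norm x} \<le> e"
    and f: "continuous_on UNIV f" "\<And>x. \<bar>f x\<bar> \<le> B"
  shows "(\<lambda>n. \<integral>x. f x \<partial>\<mu> n) \<longlonglongrightarrow> (\<integral>x. f x \<partial>\<nu>)"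
proof (rule LIMSEQ_I)
  fix r :: real assume "r > 0"
  have fin: "finite_measure (\<mu> n)" "finite_measure \<nu>" for n
    using prob by (auto intro: prob_space.finite_measure)
  have B: "B \<ge> 0" using f(2)[of 0] by linarith
  \<comment> \<open>Each replacement of \<open>f\<close> by \<open>g\<close> costs at most
    \<open>(2 * B + 2) * e\<close>, which this choice keeps below or equal to \<open>r / 4\<close>;
    two of them and the \<open>r / 4\<close> for \<open>g\<close> stay below \<open>r\<close>. The
    cap 1 gives \<open>\<bar>f x - g x\<bar> \<le> 2 * B + 1\<close>.\<close>
  define e where "e = min 1 (r / (8 * (B + 2)))"
  have e: "0 < e" "e \<le> 1" using \<open>r > 0\<close> B by (auto simp: e_def)
  obtain L1 where L1: "\<And>n. measure (\<mu> n) {x. L1 < norm x} \<le> e"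
    using tight[OF e(1)] by blast
  obtain N where N: "measure \<nu> {x. real N < norm x} \<le> e"
    using order_tendstoD(2)[OF measure_norm_tail_tendsto_zero[OF fin(2) sets(2)] e(1)]
    by (auto simp: eventually_sequentially intro: less_imp_le)
  define L where "L = max L1 (real N)"
  have mono: "measure \<rho> {x. L < norm x} \<le> e"
    if "measure \<rho> {x. L' < norm x} \<le> e" "L' \<le> L" "finite_measure \<rho>" "sets \<rho> = sets borel"
    for \<rho> :: "'a measure" and L'
  proof -
    have "measure \<rho> {x. L < norm x} \<le> measure \<rho> {x. L' < norm x}"
      using that by (intro finite_measure.finite_measure_mono)
        (auto intro!: borel_open open_Collect_less continuous_intros)
    with that show ?thesis by simp
  qed
  have tail: "measure (\<mu> n) {x. L < norm x} \<le> e" "measure \<nu> {x. L < norm x} \<le> e" for n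
    by (rule mono[OF L1] mono[OF N]; simp add: L_def fin sets)+
  obtain g where g: "trig_poly (\<lambda>x. of_real (g x))"
    "\<And>x. norm x \<le> L \<Longrightarrow> \<bar>f x - g x\<bar> \<le> e" "\<And>x. \<bar>g x\<bar> \<le> B + e"
    using trig_poly_approximation[OF f e(1)] by metis
  have g_int: "integrable \<rho> g" if "finite_measure \<rho>" "sets \<rho> = sets borel" for \<rho>
    using trig_poly_integrable[OF g(1) that] by (simp add: complex_of_real_integrable_eq)
  have f_int: "integrable \<rho> f" if "finite_measure \<rho>" "sets \<rho> = sets borel" for \<rho>
    using that f(2) borel_measurable_continuous_onI[OF f(1)] measurable_cong_sets[OF that(2) refl]
    by (intro finite_measure.integrable_const_bound[where B=B]) auto
  have bound: "\<bar>f x - g x\<bar> \<le> 2 * B + 1" for x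
    using f(2)[of x] g(3)[of x] e(2) by linarith
  have approx: "\<bar>(\<integral>x. f x \<partial>\<rho>) - (\<integral>x. g x \<partial>\<rho>)\<bar> \<le> (2 * B + 2) * e"
    if "prob_space \<rho>" "sets \<rho> = sets borel" "measure \<rho> {x. L < norm x} \<le> e" for \<rho>
  proof -
    have "\<bar>(\<integral>x. f x \<partial>\<rho>) - (\<integral>x. g x \<partial>\<rho>)\<bar> \<le> e + (2 * B + 1) * measure \<rho> {x. L < norm x}"
      using e(1) by (intro abs_integral_diff_le_tail f_int g_int that g(2) bound
          prob_space.finite_measure) auto
    also have "\<dots> \<le> e + (2 * B + 1) * e"
      using that B by (intro add_left_mono mult_left_mono) auto
    finally show ?thesis by (simp add: algebra_simps)
  qed
  have "(\<lambda>n. complex_of_real (\<integral>x. g x \<partial>\<mu> n)) \<longlonglongrightarrow> complex_of_real (\<integral>x. g x \<partial>\<nu>)"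
    using trig_poly_integral_tendsto[OF g(1) fin(1) sets(1) fin(2) sets(2) char] by simp
  then have "(\<lambda>n. \<integral>x. g x \<partial>\<mu> n) \<longlonglongrightarrow> (\<integral>x. g x \<partial>\<nu>)"
    by (simp add: tendsto_of_real_iff)
  from LIMSEQ_D[OF this, of "r / 4"] \<open>r > 0\<close>
  obtain n0 where n0: "\<And>n. n \<ge> n0 \<Longrightarrow> \<bar>(\<integral>x. g x \<partial>\<mu> n) - (\<integral>x. g x \<partial>\<nu>)\<bar> < r / 4"
    by (metis real_norm_def divide_pos_pos zero_less_numeral)
  have "(2 * B + 2) * e \<le> r / 4"
  proof -
    have "(2 * B + 2) * e \<le> (2 * (B + 2)) * (r / (8 * (B + 2)))"
      using B e(1) by (intro mult_mono) (auto simp: e_def)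
    also have "\<dots> = r / 4" using B by (simp add: field_simps)
    finally show ?thesis .
  qed
  then have "\<bar>(\<integral>x. f x \<partial>\<mu> n) - (\<integral>x. f x \<partial>\<nu>)\<bar> < r" if "n \<ge> n0" for n
    using n0[OF that] approx[OF prob(1) sets(1) tail(1), of n] approx[OF prob(2) sets(2) tail(2)]
      \<open>r > 0\<close> by linarith
  then show "\<exists>no. \<forall>n\<ge>no. norm ((\<integral>x. f x \<partial>\<mu> n) - (\<integral>x. f x \<partial>\<nu>)) < r"
    unfolding real_norm_def by blast
qed

text \<open>Testing the image law against \<open>h\<close> is testing the original law against
  \<open>h\<close> composed with \<open>\<psi>\<close>, which is again bounded and
  continuous.\<close>

lemma tight_char_tendsto_imp_weak_conv_continuous_image:
  fixes \<mu> :: "nat \<Rightarrow> 'a::euclidean_space measure" and \<psi> :: "'a \<Rightarrow> real"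
  assumes prob: "\<And>n. prob_space (\<mu> n)" "prob_space \<nu>"
    and sets: "\<And>n. sets (\<mu> n) = sets borel" "sets \<nu> = sets borel"
    and char: "\<And>t. (\<lambda>n. CLINT x|\<mu> n. iexp (t \<bullet> x)) \<longlonglongrightarrow> (CLINT x|\<nu>. iexp (t \<bullet> x))"
    and tight: "\<And>e. e > 0 \<Longrightarrow> \<exists>L. \<forall>n. measure (\<mu> n) {x. L < norm x} \<le> e"
    and \<psi>: "continuous_on UNIV \<psi>"
  shows "weak_conv_m (\<lambda>n. distr (\<mu> n) borel \<psi>) (distr \<nu> borel \<psi>)"
proof (rule integral_bdd_continuous_conv_imp_weak_conv)
  have meas: "\<psi> \<in> borel_measurable \<rho>" if "sets \<rho> = sets borel" for \<rho>
    using borel_measurable_continuous_onI[OF \<psi>] measurable_cong_sets[OF that refl] by auto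
  show "real_distribution (distr (\<mu> n) borel \<psi>)" "real_distribution (distr \<nu> borel \<psi>)" for n
    by (intro prob_space.real_distribution_distr prob meas sets)+
  fix h :: "real \<Rightarrow> real"
  assume h: "\<And>x. isCont h x" "\<And>x. \<bar>h x\<bar> \<le> 1"
  then have cont: "continuous_on UNIV h" by (simp add: continuous_at_imp_continuous_on)
  have "(\<lambda>n. \<integral>x. h (\<psi> x) \<partial>\<mu> n) \<longlonglongrightarrow> (\<integral>x. h (\<psi> x) \<partial>\<nu>)"
    by (rule tight_char_tendsto_imp_integral_tendsto[OF prob sets char tight, where B=1])
      (use h(2) in \<open>auto intro: continuous_on_compose2[OF cont \<psi>]\<close>)
  then show "(\<lambda>n. \<integral>x. h x \<partial>distr (\<mu> n) borel \<psi>) \<longlonglongrightarrow> (\<integral>x. h x \<partial>distr \<nu> borel \<psi>)"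
    by (subst (1 2) integral_distr)
      (use meas sets borel_measurable_continuous_onI[OF cont] in auto)
qed

subsection \<open>Sums of independent identically distributed variables\<close>

context prob_space
begin

lemma indep_vars_reindex:
  assumes "indep_vars (\<lambda>_. N) X I" "inj_on f J" "f ` J \<subseteq> I"
  shows "indep_vars (\<lambda>_. N) (\<lambda>j. X (f j)) J"
proof -
  let ?F = "\<lambda>i. {X i -` A \<inter> space M |A. A \<in> sets N}"
  have rv: "\<forall>i\<in>I. random_variable N (X i)" and sets: "indep_sets ?F I"
    using assms(1) by (simp_all add: indep_vars_def2)
  have "indep_sets (\<lambda>j. ?F (f j)) J"
    unfolding indep_sets_def
  proof (intro conjI ballI allI impI)
    show "?F (f j) \<subseteq> events" if "j \<in> J" for j
    proof -
      have "random_variable N (X (f j))"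
        using rv that assms(3) by blast
      then show ?thesis
        by (auto intro: measurable_sets)
    qed
    fix K A assume K: "K \<subseteq> J" "K \<noteq> {}" "finite K" and A: "A \<in> Pi K (\<lambda>j. ?F (f j))"
    define g where "g = the_inv_into K f"
    have inj: "inj_on f K" using assms(2) K(1) by (rule inj_on_subset)
    have g: "g (f j) = j" if "j \<in> K" for j
      unfolding g_def by (rule the_inv_into_f_f[OF inj that])
    have "prob (\<Inter>i\<in>f ` K. A (g i)) = (\<Prod>i\<in>f ` K. prob (A (g i)))"
    proof (rule indep_setsD[OF sets])
      show "\<forall>i\<in>f ` K. A (g i) \<in> ?F i"
        using A g by (simp add: Pi_iff)
      show "f ` K \<subseteq> I" "f ` K \<noteq> {}" "finite (f ` K)"
        using K assms(3) by blast+
    qed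
    then show "prob (\<Inter>j\<in>K. A j) = (\<Prod>j\<in>K. prob (A j))"
      using g by (simp add: prod.reindex[OF inj])
  qed
  moreover have "\<forall>j\<in>J. random_variable N (X (f j))"
    using rv assms(3) by blast
  ultimately show ?thesis
    by (simp add: indep_vars_def2)
qed

lemma distr_compose_eq:
  assumes "X \<in> measurable M N" "Y \<in> measurable M N" "distr M N X = distr M N Y" "g \<in> measurable N L"
  shows "distr M L (\<lambda>\<omega>. g (X \<omega>)) = distr M L (\<lambda>\<omega>. g (Y \<omega>))"
  using distr_distr[OF assms(4,1)] distr_distr[OF assms(4,2)] assms(3) by (simp add: comp_def)

lemma expectation_eq_if_distr_eq:
  fixes X Y :: "'a \<Rightarrow> 'c::topological_space" and g :: "'c \<Rightarrow> 'b::{banach, second_countable_topology}"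
  assumes "random_variable borel X" "random_variable borel Y" "distr M borel X = distr M borel Y"
    and "g \<in> borel_measurable borel"
  shows "expectation (\<lambda>\<omega>. g (X \<omega>)) = expectation (\<lambda>\<omega>. g (Y \<omega>))"
  using integral_distr[OF assms(1,4)] integral_distr[OF assms(2,4)] assms(3) by simp

lemma integrable_iff_if_distr_eq:
  fixes X Y :: "'a \<Rightarrow> 'c::topological_space" and g :: "'c \<Rightarrow> 'b::{banach, second_countable_topology}"
  assumes "random_variable borel X" "random_variable borel Y" "distr M borel X = distr M borel Y"
    and "g \<in> borel_measurable borel"
  shows "integrable M (\<lambda>\<omega>. g (X \<omega>)) \<longleftrightarrow> integrable M (\<lambda>\<omega>. g (Y \<omega>))"
  using integrable_distr_eq[OF assms(1,4)] integrable_distr_eq[OF assms(2,4)] assms(3) by simp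

text \<open>Hoeffding's inequality for a range of length 1; the leading factor 2 accounts for both
  signs of the deviation.\<close>

lemma iid_deviation_bound:
  fixes X :: "nat \<Rightarrow> 'a \<Rightarrow> real"
  assumes indep: "indep_vars (\<lambda>_. borel) X {1..}"
    and distr: "\<And>n. n \<ge> 1 \<Longrightarrow> distr M borel (X n) = distr M borel (X 1)"
    and unit: "AE \<omega> in M. X 1 \<omega> \<in> {0..1}"
    and "\<epsilon> \<ge> 0" "n \<ge> 1"
  shows "prob {\<omega>\<in>space M. \<bar>(\<Sum>j=1..n. X j \<omega>) / real n - expectation (X 1)\<bar> \<ge> \<epsilon>}
    \<le> 2 * exp (- 2 * real n * \<epsilon>\<^sup>2)"
proof -
  interpret Hoeffding_ineq_iid M "{1..n}" X "X 1" 0 1 "expectation (X 1)"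
  proof unfold_locales
    show "indep_vars (\<lambda>_. borel) X {1..n}"
      by (rule indep_vars_subset[OF indep]) auto
    show "random_variable borel (X 1)"
      using indep by (simp add: indep_vars_def2)
    show "distr M borel (X i) = distr M borel (X 1)" if "i \<in> {1..n}" for i
      using that by (intro distr) auto
  qed (use unit in auto)
  show ?thesis
    using Hoeffding_ineq_abs_ge'[of \<epsilon>] assms(4,5) by (simp del: expectation_X)
qed

lemma iid_average_AE_tendsto:
  fixes X :: "nat \<Rightarrow> 'a \<Rightarrow> real"
  assumes indep: "indep_vars (\<lambda>_. borel) X {1..}"
    and distr: "\<And>n. n \<ge> 1 \<Longrightarrow> distr M borel (X n) = distr M borel (X 1)"
    and unit: "AE \<omega> in M. X 1 \<omega> \<in> {0..1}"
  shows "AE \<omega> in M. (\<lambda>n. (\<Sum>j=1..n. X j \<omega>) / real n) \<longlonglongrightarrow> expectation (X 1)"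
proof -
  have [measurable]: "random_variable borel (X j)" if "j \<ge> 1" for j
    using indep that by (simp add: indep_vars_def2)
  define D where "D n \<omega> = \<bar>(\<Sum>j=1..n. X j \<omega>) / real n - expectation (X 1)\<bar>" for n \<omega>
  have D[measurable]: "random_variable borel (D n)" for n
    unfolding D_def by measurable
  have "AE \<omega> in M. \<forall>\<^sub>F n in sequentially. D n \<omega> < e" if "e > 0" for e
  proof -
    have "AE \<omega> in M. \<forall>\<^sub>F n in sequentially. \<omega> \<in> space M - {\<omega>\<in>space M. D n \<omega> \<ge> e}"
    proof (rule borel_cantelli_AE1)
      show "summable (\<lambda>n. prob {\<omega>\<in>space M. D n \<omega> \<ge> e})"
      proof (rule summable_comparison_test')
        \<comment> \<open>For fixed \<open>e\<close> the Hoeffding bound is a geometric sequence in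
          \<open>n\<close>.\<close>
        show "summable (\<lambda>n. 2 * exp (- 2 * e\<^sup>2) ^ n)"
          using \<open>e > 0\<close> by (intro summable_mult summable_geometric) auto
        show "norm (prob {\<omega>\<in>space M. D n \<omega> \<ge> e}) \<le> 2 * exp (- 2 * e\<^sup>2) ^ n" if "n \<ge> 1" for n
          using iid_deviation_bound[OF indep distr unit _ that, of e] \<open>e > 0\<close>
          by (simp add: D_def exp_of_nat_mult[symmetric] mult_ac)
      qed
    qed (auto simp: less_top[symmetric])
    then show ?thesis
      by (rule AE_mp) (auto intro!: AE_I2 elim: eventually_mono)
  qed
  \<comment> \<open>Only countably many tolerances are taken, so that their exceptional null sets
    unite to a null set.\<close>
  then have "AE \<omega> in M. \<forall>k. \<forall>\<^sub>F n in sequentially. D n \<omega> < 1 / real (Suc k)"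
    by (subst AE_all_countable) auto
  then show ?thesis
  proof (rule AE_mp, intro AE_I2 impI)
    fix \<omega> assume small: "\<forall>k. \<forall>\<^sub>F n in sequentially. D n \<omega> < 1 / real (Suc k)"
    show "(\<lambda>n. (\<Sum>j=1..n. X j \<omega>) / real n) \<longlonglongrightarrow> expectation (X 1)"
    proof (rule tendstoI)
      fix e :: real assume "e > 0"
      then obtain k where "1 / real (Suc k) < e"
        using nat_approx_posE by blast
      with small[rule_format, of k]
      show "\<forall>\<^sub>F n in sequentially. dist ((\<Sum>j=1..n. X j \<omega>) / real n) (expectation (X 1)) < e"
        by (auto elim!: eventually_mono simp: D_def dist_real_def)
    qed
  qed
qed

text \<open>The central limit theorem normalises by the standard deviation \<open>\<sigma>\<close>;
  evaluating the characteristic functions at \<open>\<sigma>\<close> removes that normalisation and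
  yields the exponent \<open>- \<sigma>\<^sup>2 / 2\<close>.\<close>

lemma iid_char_tendsto:
  fixes X :: "nat \<Rightarrow> 'a \<Rightarrow> real"
  assumes indep: "indep_vars (\<lambda>_. borel) X {1..}"
    and distr: "\<And>n. n \<ge> 1 \<Longrightarrow> distr M borel (X n) = distr M borel (X 1)"
    and square: "integrable M (\<lambda>\<omega>. (X 1 \<omega>)\<^sup>2)"
    and mean: "expectation (X 1) = 0"
  shows "(\<lambda>n. CLINT \<omega>|M. iexp ((\<Sum>j=1..n. X j \<omega>) / sqrt (real n)))
    \<longlonglongrightarrow> of_real (exp (- expectation (\<lambda>\<omega>. (X 1 \<omega>)\<^sup>2) / 2))"
proof -
  have rv[measurable]: "random_variable borel (X j)" if "j \<ge> 1" for j
    using indep that by (simp add: indep_vars_def2)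
  define s2 where "s2 = expectation (\<lambda>\<omega>. (X 1 \<omega>)\<^sup>2)"
  have s2: "s2 \<ge> 0" unfolding s2_def by (intro integral_nonneg_AE) auto
  show ?thesis
  proof (cases "s2 = 0")
    case True
    have "AE \<omega> in M. X 1 \<omega> = 0"
      using True integral_nonneg_eq_0_iff_AE[OF square] by (simp add: s2_def)
    \<comment> \<open>A vanishing second moment forces \<open>X 1 = 0\<close> almost surely; passing
      through the law carries this to every \<open>X j\<close>, and all the integrands are then
      almost surely 1.\<close>
    then have "AE x in distr M borel (X 1). x = 0"
      by (subst AE_distr_iff) auto
    then have zero: "AE \<omega> in M. X j \<omega> = 0" if "j \<ge> 1" for j
      using that by (subst (asm) distr[OF that, symmetric], subst (asm) AE_distr_iff) auto
    have "AE \<omega> in M. iexp ((\<Sum>j=1..n. X j \<omega>) / sqrt (real n)) = 1" for n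
    proof -
      have "AE \<omega> in M. \<forall>j\<in>{1..n}. X j \<omega> = 0"
        using zero by (subst AE_ball_countable) auto
      then show ?thesis
        by (rule AE_mp) (auto intro!: AE_I2)
    qed
    then have "(CLINT \<omega>|M. iexp ((\<Sum>j=1..n. X j \<omega>) / sqrt (real n))) = (CLINT \<omega>|M. 1)" for n
      by (intro integral_cong_AE) auto
    then show ?thesis
      using True by (simp add: s2_def prob_space)
  next
    case False
    define \<sigma> where "\<sigma> = sqrt s2"
    have \<sigma>: "\<sigma> > 0" "\<sigma>\<^sup>2 = s2" using False s2 by (auto simp: \<sigma>_def)
    define S where "S n \<omega> = (\<Sum>i<n. X (Suc i) \<omega>) / sqrt (real n * \<sigma>\<^sup>2)" for n \<omega>
    have S[measurable]: "random_variable borel (S n)" for n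
      unfolding S_def by measurable
    have "weak_conv_m (\<lambda>n. distr M borel (S n)) std_normal_distribution"
      unfolding S_def
    proof (rule central_limit_theorem_zero_mean[OF indep_vars_reindex[OF indep] _ \<sigma>(1)])
      show "inj Suc" "range Suc \<subseteq> {1..}" by auto
      fix n
      note eq = expectation_eq_if_distr_eq[OF rv rv distr[of "Suc n"]]
      show mean': "expectation (X (Suc n)) = 0"
        using eq[of "\<lambda>x. x"] mean by simp
      show "integrable M (\<lambda>\<omega>. (X (Suc n) \<omega>)\<^sup>2)"
        using integrable_iff_if_distr_eq[OF rv rv distr[of "Suc n"], of "\<lambda>x. x\<^sup>2"] square by simp
      show "variance (X (Suc n)) = \<sigma>\<^sup>2"
        using eq[of "\<lambda>x. x\<^sup>2"] mean' \<sigma>(2) by (simp add: s2_def)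
      show "distr M borel (X (Suc n)) = distr M borel (X 1)"
        by (rule distr) simp
    qed
    then have "(\<lambda>n. char (distr M borel (S n)) \<sigma>) \<longlonglongrightarrow> char std_normal_distribution \<sigma>"
      by (intro levy_continuity1)
        (auto simp: real_dist_normal_dist)
    moreover have "char (distr M borel (S n)) \<sigma> =
        (CLINT \<omega>|M. iexp ((\<Sum>j=1..n. X j \<omega>) / sqrt (real n)))" for n
    proof -
      have "(\<Sum>i<n. X (Suc i) \<omega>) = (\<Sum>j=1..n. X j \<omega>)" for \<omega>
        by (induction n) auto
      then have "\<sigma> * S n \<omega> = (\<Sum>j=1..n. X j \<omega>) / sqrt (real n)" for \<omega>
        using \<sigma>(1) by (simp add: S_def real_sqrt_mult)
      then show ?thesis
        unfolding char_def by (subst integral_distr) auto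
    qed
    moreover have "char std_normal_distribution \<sigma> = of_real (exp (- s2 / 2))"
      by (simp add: char_std_normal_distribution \<sigma>(2))
    ultimately show ?thesis
      by (simp add: s2_def)
  qed
qed

end

subsection \<open>Random means and their expectation\<close>

lemma cube_Icc: "cube {u..v} = cbox (\<chi> i. u) (\<chi> i. v)"
  by (auto simp: cube_def mem_box_cart)

lemma mspace_cont_space:
  fixes I :: "real set" and f :: "real ^ 'p \<Rightarrow> real"
  assumes "compact (cube I :: (real ^ 'p) set)"
  shows "f \<in> mspace (cont_space I) \<longleftrightarrow> f \<in> extensional (cube I) \<and> continuous_on (cube I) f"
  using assms by (subst compactin_mspace_cfunspace) (auto simp: compactin_subtopology)

lemma means_memD:
  assumes "m \<in> means I" "x \<in> cube I"
  shows "m x \<in> {Min (range (($) x))..Max (range (($) x))}"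
  using assms by (auto simp: means_def)

lemma means_bounds:
  assumes "m \<in> means {u..v}" "x \<in> cube {u..v}"
  shows "m x \<in> {u..v}"
proof -
  have "u \<le> Min (range (($) x))" "Max (range (($) x)) \<le> v"
    using assms(2) by (auto simp: cube_def)
  then show ?thesis
    using means_memD[OF assms] unfolding atLeastAtMost_iff by linarith
qed

section \<open>Simple functions with continuous functions as values, and their integral\<close>

lemma simple_function_measurable_borel_cont:
  assumes "simple_function P s" "s \<in> space P \<rightarrow> mspace (cont_space I)"
  shows "s \<in> P \<rightarrow>\<^sub>M borel_cont I"
proof (rule measurableI)
  show "s x \<in> space (borel_cont I)" if "x \<in> space P" for x
    using assms(2) that by (auto simp: borel_cont_def space_measure_of_conv)
  \<comment> \<open>Every preimage under a simple function is measurable, so the generators of the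
    target sigma-algebra need not be examined.\<close>
  show "s -` A \<inter> space P \<in> sets P" for A
    using measurable_sets[OF measurable_simple_function[OF assms(1)], of A] by simp
qed

text \<open>Evaluation at a point commutes with the integral, because \<open>s\<close> is a finite
  combination of indicators of its level sets. Computations in the function space thus become real
  integrals.\<close>

lemma simple_integral_cont_eq_integral:
  assumes "finite_measure P" "simple_function P s" "x \<in> cube I"
  shows "integrable P (\<lambda>\<omega>. s \<omega> x)" "simple_integral_cont P I s x = (\<integral>\<omega>. s \<omega> x \<partial>P)"
proof -
  interpret finite_measure P by fact
  let ?E = "\<lambda>h. {\<omega>\<in>space P. s \<omega> = h}"
  have fin: "finite (s ` space P)"
    using assms(2) by (simp add: simple_function_def)
  have E: "?E h \<in> sets P" for h
    using measurable_sets[OF measurable_simple_function[OF assms(2)], of "{h}"]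
    by (simp add: vimage_def Int_def conj_commute)
  have eq: "s \<omega> x = (\<Sum>h\<in>s ` space P. indicator (?E h) \<omega> * h x)" if "\<omega> \<in> space P" for \<omega>
  proof -
    have "(\<Sum>h\<in>s ` space P. indicator (?E h) \<omega> * h x) = (\<Sum>h\<in>{s \<omega>}. indicator (?E h) \<omega> * h x)"
      using fin that by (intro sum.mono_neutral_right) (auto simp: indicator_def)
    then show ?thesis using that by simp
  qed
  have int: "integrable P (\<lambda>\<omega>. indicator (?E h) \<omega> * h x)" for h
    using E by (intro integrable_mult_left integrable_real_indicator) (auto simp: less_top[symmetric])
  show "integrable P (\<lambda>\<omega>. s \<omega> x)"
    using Bochner_Integration.integrable_sum[OF int]
    by (subst Bochner_Integration.integrable_cong[OF refl eq]) auto
  have "(\<integral>\<omega>. s \<omega> x \<partial>P) = (\<integral>\<omega>. (\<Sum>h\<in>s ` space P. indicator (?E h) \<omega> * h x) \<partial>P)"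
    using eq by (intro Bochner_Integration.integral_cong) auto
  also have "\<dots> = (\<Sum>h\<in>s ` space P. (\<integral>\<omega>. indicator (?E h) \<omega> * h x \<partial>P))"
    by (rule Bochner_Integration.integral_sum[OF int])
  also have "\<dots> = (\<Sum>h\<in>s ` space P. measure P (?E h) * h x)"
    using E by (intro sum.cong) auto
  finally show "simple_integral_cont P I s x = (\<integral>\<omega>. s \<omega> x \<partial>P)"
    using assms(3) by (simp add: simple_integral_cont_def)
qed

text \<open>The contraction estimate behind uniqueness of the expected value: the integrand at each
  \<open>x\<close> is dominated by the supremum distance.\<close>

lemma simple_integral_cont_diff_le:
  assumes "finite_measure P"
    and "simple_function P s" "s \<in> space P \<rightarrow> mspace (cont_space I)"
    and "simple_function P t" "t \<in> space P \<rightarrow> mspace (cont_space I)"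
    and "x \<in> cube I"
  shows "ennreal \<bar>simple_integral_cont P I s x - simple_integral_cont P I t x\<bar>
    \<le> (\<integral>\<^sup>+\<omega>. ennreal (mdist (cont_space I) (s \<omega>) (t \<omega>)) \<partial>P)"
proof -
  note s = simple_integral_cont_eq_integral[OF assms(1,2,6)]
  note t = simple_integral_cont_eq_integral[OF assms(1,4,6)]
  have "ennreal \<bar>simple_integral_cont P I s x - simple_integral_cont P I t x\<bar>
      = ennreal (norm (\<integral>\<omega>. s \<omega> x - t \<omega> x \<partial>P))"
    using s t by simp
  also have "\<dots> \<le> (\<integral>\<^sup>+\<omega>. norm (s \<omega> x - t \<omega> x) \<partial>P)"
    using s t by (intro integral_norm_bound_ennreal) auto
  also have "\<dots> \<le> (\<integral>\<^sup>+\<omega>. ennreal (mdist (cont_space I) (s \<omega>) (t \<omega>)) \<partial>P)"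
  proof (intro nn_integral_mono ennreal_leI)
    fix \<omega> assume "\<omega> \<in> space P"
    then have "s \<omega> \<in> mspace (cont_space I)" "t \<omega> \<in> mspace (cont_space I)"
      using assms by auto
    from mdist_cfunspace_imp_mdist_le[OF this order_refl]
    show "norm (s \<omega> x - t \<omega> x) \<le> mdist (cont_space I) (s \<omega>) (t \<omega>)"
      using assms(6) by (simp add: dist_norm)
  qed
  finally show ?thesis .
qed

lemma simple_integral_cont_mspace:
  fixes I :: "real set" and s :: "'a \<Rightarrow> real ^ 'p \<Rightarrow> real"
  assumes "compact (cube I :: (real ^ 'p) set)" "s \<in> space P \<rightarrow> mspace (cont_space I)"
  shows "simple_integral_cont P I s \<in> mspace (cont_space I)"
proof -
  have "continuous_on (cube I) h" if "h \<in> s ` space P" for h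
    using assms that by (auto simp: mspace_cont_space[OF assms(1)])
  then show ?thesis
    unfolding mspace_cont_space[OF assms(1)] simple_integral_cont_def
    by (auto intro!: continuous_intros simp: continuous_on_restrict)
qed

text \<open>A simple function serves as its own constant approximating sequence.\<close>

lemma has_expectation_cont_simple:
  fixes I :: "real set" and s :: "'a \<Rightarrow> real ^ 'p \<Rightarrow> real"
  assumes "compact (cube I :: (real ^ 'p) set)"
    and "simple_function P s" "s \<in> space P \<rightarrow> mspace (cont_space I)"
  shows "has_expectation_cont P I s (simple_integral_cont P I s)"
  unfolding has_expectation_cont_def
proof (intro conjI exI[of _ "\<lambda>_. s"] allI)
  show "s \<in> P \<rightarrow>\<^sub>M borel_cont I"
    by (rule simple_function_measurable_borel_cont[OF assms(2,3)])
  have "(\<integral>\<^sup>+\<omega>. ennreal (mdist (cont_space I) (s \<omega>) (s \<omega>)) \<partial>P) = (\<integral>\<^sup>+\<omega>. 0 \<partial>P)"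
  proof (rule nn_integral_cong)
    fix \<omega> assume "\<omega> \<in> space P"
    then have "s \<omega> \<in> mspace (cont_space I)" using assms(3) by blast
    from mdist_zero[OF this this]
    show "ennreal (mdist (cont_space I) (s \<omega>) (s \<omega>)) = 0" by simp
  qed
  then show "(\<lambda>n. \<integral>\<^sup>+\<omega>. ennreal (mdist (cont_space I) (s \<omega>) (s \<omega>)) \<partial>P) \<longlonglongrightarrow> 0"
    by simp
  show "limitin (mtopology_of (cont_space I)) (\<lambda>n. simple_integral_cont P I s)
      (simple_integral_cont P I s) sequentially"
    using simple_integral_cont_mspace[OF assms(1,3)]
    unfolding Abstract_Limits.limitin_const_iff topspace_mtopology_of .
qed (use assms in auto)

lemma limitin_cont_space_pointwise:
  assumes "limitin (mtopology_of (cont_space I)) f e sequentially" "x \<in> cube I"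
  shows "(\<lambda>n. f n x) \<longlonglongrightarrow> e x"
proof (rule LIMSEQ_I)
  interpret Metric_space "mspace (cont_space I)" "mdist (cont_space I)"
    by (rule Metric_space_mspace_mdist)
  fix r :: real assume "r > 0"
  have lim: "e \<in> mspace (cont_space I)"
    "\<And>r. r > 0 \<Longrightarrow> \<exists>N. \<forall>n\<ge>N. f n \<in> mspace (cont_space I) \<and> mdist (cont_space I) (f n) e < r"
    using assms(1) unfolding mtopology_of_def limit_metric_sequentially by blast+
  then obtain N where N: "\<And>n. n \<ge> N \<Longrightarrow> f n \<in> mspace (cont_space I)"
    "\<And>n. n \<ge> N \<Longrightarrow> mdist (cont_space I) (f n) e < r"
    using \<open>r > 0\<close> by meson
  have "norm (f n x - e x) < r" if "n \<ge> N" for n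
    using mdist_cfunspace_imp_mdist_le[OF N(1)[OF that] lim(1) order_refl, of x] N(2)[OF that] assms(2)
    by (simp add: dist_norm del: mspace_cfunspace)
  then show "\<exists>no. \<forall>n\<ge>no. norm (f n x - e x) < r" by blast
qed

text \<open>The description by \<open>THE\<close> requires uniqueness. For any approximating
  sequence the contraction estimate makes the simple integrals converge at each point of the cube to
  that of \<open>s\<close>; off the cube both candidates are \<open>undefined\<close>.\<close>

lemma expectation_cont_simple:
  fixes I :: "real set" and s :: "'a \<Rightarrow> real ^ 'p \<Rightarrow> real"
  assumes "finite_measure P" "compact (cube I :: (real ^ 'p) set)"
    and s: "simple_function P s" "s \<in> space P \<rightarrow> mspace (cont_space I)"
  shows "expectation_cont P I s = simple_integral_cont P I s"
  unfolding expectation_cont_def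
proof (rule the_equality)
  show "has_expectation_cont P I s (simple_integral_cont P I s)"
    by (rule has_expectation_cont_simple[OF assms(2) s])
  fix e assume "has_expectation_cont P I s e"
  then obtain t where t: "\<And>n. simple_function P (t n)" "\<And>n. t n \<in> space P \<rightarrow> mspace (cont_space I)"
    and lim: "(\<lambda>n. \<integral>\<^sup>+\<omega>. ennreal (mdist (cont_space I) (s \<omega>) (t n \<omega>)) \<partial>P) \<longlonglongrightarrow> 0"
    and e: "limitin (mtopology_of (cont_space I)) (\<lambda>n. simple_integral_cont P I (t n)) e sequentially"
    unfolding has_expectation_cont_def by blast
  show "e = simple_integral_cont P I s"
  proof (rule extensionalityI[of _ "cube I"])
    have "e \<in> mspace (cont_space I)"
      using limitin_topspace[OF e] unfolding topspace_mtopology_of .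
    then show "e \<in> extensional (cube I)" by simp
    show "simple_integral_cont P I s \<in> extensional (cube I)"
      by (simp add: simple_integral_cont_def)
    fix x :: "real ^ 'p" assume x: "x \<in> cube I"
    have "(\<lambda>n. ennreal \<bar>simple_integral_cont P I s x - simple_integral_cont P I (t n) x\<bar>) \<longlonglongrightarrow> 0"
      by (rule tendsto_sandwich[OF _ _ tendsto_const lim])
        (auto intro!: always_eventually simple_integral_cont_diff_le[OF assms(1) s t x])
    then have "(\<lambda>n. \<bar>simple_integral_cont P I s x - simple_integral_cont P I (t n) x\<bar>) \<longlonglongrightarrow> 0"
      by (subst (asm) ennreal_0[symmetric], subst (asm) tendsto_ennreal_iff) auto
    from tendsto_diff[OF tendsto_const tendsto_rabs_zero_cancel[OF this], of "simple_integral_cont P I s x"]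
    have "(\<lambda>n. simple_integral_cont P I (t n) x) \<longlonglongrightarrow> simple_integral_cont P I s x"
      by simp
    then show "e x = simple_integral_cont P I s x"
      using limitin_cont_space_pointwise[OF e x] by (rule LIMSEQ_unique[symmetric])
  qed
qed

lemma random_mean_finite_range:
  fixes I :: "real set" and m :: "'k::finite \<Rightarrow> real ^ 'p \<Rightarrow> real" and a :: "'k \<Rightarrow> real ^ 'd"
  assumes "prob_space P" "\<xi> \<in> borel_measurable P" "\<xi> ` space P \<subseteq> range a" "inj a"
    and I: "I = {u..v}" "u < v" and m: "\<And>i. m i \<in> means I"
  defines "M \<equiv> (\<lambda>\<omega>. \<lambda>x\<in>cube I. \<Sum>i\<in>UNIV. m i x * indicator {a i} (\<xi> \<omega>))"
  shows "random_mean P I \<xi> M" "simple_function P M" "M \<in> space P \<rightarrow> mspace (cont_space I)"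
proof -
  interpret prob_space P by fact
  have mspace: "m i \<in> mspace (cont_space I)" for i
    using m[of i] unfolding means_def by blast
  have compact: "compact (cube I :: (real ^ 'p) set)"
    unfolding I cube_Icc by simp
  have cont: "continuous_on (cube I) (m i)" for i
    using mspace[of i] unfolding mspace_cont_space[OF compact] by blast
  have ext: "m i \<in> extensional (cube I)" for i
    using mspace[of i] unfolding mspace_cont_space[OF compact] by blast
  define f where "f y = (\<lambda>x. \<Sum>i\<in>UNIV. m i x * indicator {a i} y)" for y
  have f: "f (a l) = m l" for l
  proof
    fix x
    have "f (a l) x = (\<Sum>i\<in>UNIV. if i = l then m i x else 0)"
      unfolding f_def using injD[OF \<open>inj a\<close>] by (intro sum.cong) (auto simp: indicator_def)
    then show "f (a l) x = m l x" by simp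
  qed
  have M_f: "M \<omega> = restrict (f (\<xi> \<omega>)) (cube I)" for \<omega>
    unfolding M_def f_def by (rule refl)
  \<comment> \<open>Since \<open>m l\<close> is extensional, restricting it changes nothing:
    \<open>M \<omega>\<close> equals some \<open>m l\<close> as a function, not merely on the
    cube.\<close>
  have M: "\<exists>l. \<xi> \<omega> = a l \<and> M \<omega> = m l" if "\<omega> \<in> space P" for \<omega>
  proof -
    have "\<xi> \<omega> \<in> range a" using subsetD[OF assms(3) imageI[OF that]] .
    then obtain l where l: "\<xi> \<omega> = a l" by (rule rangeE)
    have "M \<omega> = m l" unfolding M_f l f by (rule extensional_restrict[OF ext])
    with l show ?thesis by blast
  qed
  show simple: "simple_function P M"
  proof -
    have "simple_function P \<xi>"
      unfolding simple_function_def
    proof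
      show "finite (\<xi> ` space P)" using assms(3) by (rule finite_subset) simp
      show "\<forall>y\<in>\<xi> ` space P. \<xi> -` {y} \<inter> space P \<in> events"
        using assms(2) by (auto intro: measurable_sets)
    qed
    then show ?thesis
      unfolding M_f by (rule simple_function_compose1)
  qed
  show mem: "M \<in> space P \<rightarrow> mspace (cont_space I)"
    using M mspace by (intro Pi_I) metis
  \<comment> \<open>The values must lie in \<open>I\<close> for every second argument. Off
    \<open>range a\<close> all indicators vanish and the sum would be 0, possibly outside
    \<open>I\<close>; the endpoint \<open>u\<close> serves as default.\<close>
  define F where "F z = (if snd z \<in> range a then f (snd z) (fst z) else u)" for z
  have F: "F \<in> restrict_space borel (cube I) \<Otimes>\<^sub>M borel \<rightarrow>\<^sub>M restrict_space borel I"
  proof (rule measurable_restrict_space2)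
    have [measurable]: "m i \<in> borel_measurable (restrict_space borel (cube I))" for i
      using cont by (rule borel_measurable_continuous_on_restrict)
    have [measurable]: "range a \<in> sets borel"
      by (intro borel_closed finite_imp_closed) simp
    show "F \<in> borel_measurable (restrict_space borel (cube I) \<Otimes>\<^sub>M borel)"
      unfolding F_def f_def by measurable
    show "F \<in> space (restrict_space borel (cube I) \<Otimes>\<^sub>M borel) \<rightarrow> I"
    proof
      fix z :: "(real ^ 'p) \<times> (real ^ 'd)"
      assume "z \<in> space (restrict_space borel (cube I) \<Otimes>\<^sub>M borel)"
      then have "fst z \<in> cube I" by (auto simp: space_pair_measure space_restrict_space)
      then show "F z \<in> I"
        using means_bounds[of _ u v "fst z"] m I by (auto simp: F_def f)
    qed
  qed
  have F_M: "(\<lambda>x\<in>cube I. F (x, \<xi> \<omega>)) = M \<omega>" if "\<omega> \<in> space P" for \<omega>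
  proof -
    have "\<xi> \<omega> \<in> range a" using subsetD[OF assms(3) imageI[OF that]] .
    then show ?thesis by (simp add: F_def M_f)
  qed
  have "M \<omega> x = F (x, \<xi> \<omega>)" if "\<omega> \<in> space P" "x \<in> cube I" for \<omega> x
    using fun_cong[OF F_M[OF that(1)], of x] that(2) by simp
  then have "{\<omega>\<in>space P. \<forall>x\<in>cube I. M \<omega> x = F (x, \<xi> \<omega>)} = space P"
    by blast
  then have "prob {\<omega>\<in>space P. \<forall>x\<in>cube I. M \<omega> x = F (x, \<xi> \<omega>)} = 1"
    by (simp add: prob_space)
  moreover have "(\<lambda>x\<in>cube I. F (x, \<xi> \<omega>)) \<in> mspace (cont_space I)" if "\<omega> \<in> space P" for \<omega>
    unfolding F_M[OF that] using mem that by blast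
  moreover have "M \<omega> \<in> means I" if "\<omega> \<in> space P" for \<omega>
    using M[OF that] m by metis
  ultimately show "random_mean P I \<xi> M"
    unfolding random_mean_def
    using F assms(2) simple_function_measurable_borel_cont[OF simple mem] by blast
qed

subsection \<open>Empirical frequencies of variables with finite range\<close>

lemma multi_normal_prob_space:
  fixes \<mu> :: "real ^ 'k" and Q :: "real ^ 'k ^ 'k"
  shows "prob_space (multi_normal \<mu> Q)"
proof -
  define A :: "real ^ 'k ^ 'k" where "A = (SOME A. A ** transpose A = Q)"
  have "(\<lambda>g. \<mu> + A *v (\<chi> i. g i)) \<in> (\<Pi>\<^sub>M i\<in>UNIV. std_normal_distribution) \<rightarrow>\<^sub>M borel"
    by (subst borel_measurable_euclidean_space)
      (auto simp: Basis_vec_def inner_axis matrix_vector_mult_def intro!: measurable_component_singleton)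
  then show ?thesis
    unfolding multi_normal_def A_def[symmetric] Let_def
    by (intro prob_space.prob_space_distr prob_space_PiM prob_space_normal_density) simp_all
qed

lemma sets_multi_normal: "sets (multi_normal \<mu> Q) = sets borel"
  by (simp add: multi_normal_def Let_def)

section \<open>The supremum seminorm\<close>

lemma bdd_above_abs_inner:
  fixes g :: "'b \<Rightarrow> 'a::real_inner"
  assumes "bounded (g ` X)"
  shows "bdd_above ((\<lambda>x. \<bar>z \<bullet> g x\<bar>) ` X)"
proof -
  obtain C where "\<And>x. x \<in> X \<Longrightarrow> norm (g x) \<le> C"
    using assms by (auto simp: bounded_iff)
  then have "\<bar>z \<bullet> g x\<bar> \<le> norm z * C" if "x \<in> X" for x
    using Cauchy_Schwarz_ineq2[of z "g x"] mult_left_mono[of "norm (g x)" C "norm z"] that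
    by fastforce
  then show ?thesis
    by (intro bdd_aboveI2)
qed

text \<open>By Cauchy-Schwarz, moving \<open>z\<close> to \<open>w\<close> changes every
  \<open>\<bar>z \<bullet> g x\<bar>\<close> by at most \<open>C * norm (z - w)\<close>, where
  \<open>C\<close> bounds \<open>g\<close>; so the supremum is Lipschitz.\<close>

lemma continuous_SUP_abs_inner:
  fixes g :: "'b \<Rightarrow> 'a::real_inner"
  assumes "X \<noteq> {}" "bounded (g ` X)"
  shows "continuous_on UNIV (\<lambda>z. SUP x\<in>X. \<bar>z \<bullet> g x\<bar>)"
proof -
  obtain C where C: "\<And>x. x \<in> X \<Longrightarrow> norm (g x) \<le> C"
    using assms(2) by (auto simp: bounded_iff)
  have bound: "\<bar>z \<bullet> g x\<bar> \<le> C * norm z" if "x \<in> X" for x z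
    using Cauchy_Schwarz_ineq2[of z "g x"] mult_left_mono[OF C[OF that], of "norm z"]
    by (simp add: mult.commute)
  note bdd = bdd_above_abs_inner[OF assms(2)]
  have le: "(SUP x\<in>X. \<bar>z \<bullet> g x\<bar>) \<le> (SUP x\<in>X. \<bar>w \<bullet> g x\<bar>) + C * norm (z - w)" for z w
  proof (rule cSUP_least[OF assms(1)])
    fix x assume x: "x \<in> X"
    have "\<bar>z \<bullet> g x\<bar> \<le> \<bar>w \<bullet> g x\<bar> + \<bar>(z - w) \<bullet> g x\<bar>"
      by (simp add: inner_diff_left)
    also have "\<dots> \<le> (SUP x\<in>X. \<bar>w \<bullet> g x\<bar>) + C * norm (z - w)"
      using x by (intro add_mono cSUP_upper bdd bound)
    finally show "\<bar>z \<bullet> g x\<bar> \<le> (SUP x\<in>X. \<bar>w \<bullet> g x\<bar>) + C * norm (z - w)" .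
  qed
  obtain x where "x \<in> X" using assms(1) by blast
  then have "C \<ge> 0" using C[of x] norm_ge_zero[of "g x"] by linarith
  have "C-lipschitz_on UNIV (\<lambda>z. SUP x\<in>X. \<bar>z \<bullet> g x\<bar>)"
  proof (rule lipschitz_onI[OF _ \<open>C \<ge> 0\<close>])
    show "dist (SUP x\<in>X. \<bar>z \<bullet> g x\<bar>) (SUP x\<in>X. \<bar>w \<bullet> g x\<bar>) \<le> C * dist z w" for z w
      using le[of z w] le[of w z] by (simp add: dist_norm norm_minus_commute abs_le_iff)
  qed
  then show ?thesis
    by (rule lipschitz_on_continuous_on)
qed

text \<open>Multiplication by a nonnegative constant is continuous and monotone, hence commutes with
  a bounded supremum. The case \<open>c = 0\<close> is included for later use.\<close>

lemma SUP_mult_left_nonneg: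
  fixes f :: "'b \<Rightarrow> real"
  assumes "X \<noteq> {}" "bdd_above (f ` X)" "c \<ge> 0"
  shows "(SUP x\<in>X. c * f x) = c * (SUP x\<in>X. f x)"
proof -
  have "c * Sup (f ` X) = (SUP y\<in>f ` X. c * y)"
    using assms by (intro continuous_at_Sup_mono) (auto simp: mono_def mult_left_mono intro!: continuous_intros)
  then show ?thesis
    by (simp add: image_image)
qed

section \<open>The multinomial covariance matrix\<close>

lemma multinomial_covariance_factor:
  fixes q :: "'k::finite \<Rightarrow> real"
  assumes "\<And>i. q i \<ge> 0" "(\<Sum>i\<in>UNIV. q i) = 1"
  shows "\<exists>A :: real ^ 'k ^ 'k. A ** transpose A =
    (\<chi> i j. if i = j then q i * (1 - q i) else - q i * q j)"
proof
  \<comment> \<open>With \<open>D\<close> the diagonal matrix of the \<open>sqrt (q i)\<close> and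
    \<open>r\<close> the vector of these roots, this is \<open>D (1 - r r^T)\<close>. As
    \<open>r\<close> is a unit vector, \<open>1 - r r^T\<close> is an orthogonal projection, so
    \<open>?A\<close> times its transpose is \<open>D (1 - r r^T) D\<close>, which is the diagonal
    matrix of the \<open>q i\<close> minus the products \<open>q i * q j\<close>.\<close>
  let ?A = "(\<chi> i j. (if i = j then sqrt (q i) else 0) - q i * sqrt (q j)) :: real ^ 'k ^ 'k"
  have "(\<Sum>l\<in>UNIV. ((if i = l then sqrt (q i) else 0) - q i * sqrt (q l)) *
      ((if j = l then sqrt (q j) else 0) - q j * sqrt (q l)))
    = (if i = j then q i * (1 - q i) else - q i * q j)" for i j
  proof -
    have "(\<Sum>l\<in>UNIV. ((if i = l then sqrt (q i) else 0) - q i * sqrt (q l)) *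
        ((if j = l then sqrt (q j) else 0) - q j * sqrt (q l)))
      = (\<Sum>l\<in>UNIV. (if i = l then (if i = j then q i else 0) - q i * q j else 0)
          - (if j = l then q i * q j else 0) + q i * q j * q l)"
    proof (intro sum.cong refl)
      fix l
      have sq: "sqrt (q l) * sqrt (q l) = q l" using assms(1) by simp
      show "((if i = l then sqrt (q i) else 0) - q i * sqrt (q l)) *
          ((if j = l then sqrt (q j) else 0) - q j * sqrt (q l))
        = (if i = l then (if i = j then q i else 0) - q i * q j else 0)
          - (if j = l then q i * q j else 0) + q i * q j * q l"
        using sq by (cases "i = l"; cases "j = l") (simp_all add: left_diff_distrib right_diff_distrib ac_simps)
    qed
    also have "\<dots> = (if i = j then q i else 0) - q i * q j - q i * q j + q i * q j * (\<Sum>l\<in>UNIV. q l)"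
      by (simp add: sum.distrib sum_subtractf sum_distrib_left)
    also have "\<dots> = (if i = j then q i * (1 - q i) else - q i * q j)"
      by (simp add: assms(2) algebra_simps)
    finally show ?thesis .
  qed
  then show "?A ** transpose ?A = (\<chi> i j. if i = j then q i * (1 - q i) else - q i * q j)"
    unfolding matrix_matrix_mult_def transpose_def vec_eq_iff by (simp only: vec_lambda_beta) simp
qed

text \<open>For probabilities \<open>q i\<close> the right side is the variance of a variable taking
  the value \<open>t $ i\<close> with probability \<open>q i\<close>.\<close>

lemma multinomial_covariance_quadratic_form:
  fixes q :: "'k::finite \<Rightarrow> real" and t :: "real ^ 'k"
  shows "t \<bullet> ((\<chi> i j. if i = j then q i * (1 - q i) else - q i * q j) *v t)
    = (\<Sum>i\<in>UNIV. q i * (t $ i)\<^sup>2) - (\<Sum>i\<in>UNIV. q i * t $ i)\<^sup>2"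
proof -
  let ?Q = "(\<chi> i j. if i = j then q i * (1 - q i) else - q i * q j) :: real ^ 'k ^ 'k"
  have Qt: "(?Q *v t) $ i = q i * t $ i - q i * (\<Sum>j\<in>UNIV. q j * t $ j)" for i
  proof -
    have "(?Q *v t) $ i = (\<Sum>j\<in>UNIV. (if i = j then q i * t $ i else 0) - q i * (q j * t $ j))"
      unfolding matrix_vector_mult_def by (auto intro!: sum.cong simp: algebra_simps)
    then show ?thesis
      by (simp add: sum_subtractf sum_distrib_left)
  qed
  have "t \<bullet> (?Q *v t)
    = (\<Sum>i\<in>UNIV. q i * (t $ i)\<^sup>2 - (q i * t $ i) * (\<Sum>j\<in>UNIV. q j * t $ j))"
    unfolding inner_vec_def Qt inner_real_def by (simp add: algebra_simps power2_eq_square)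
  then show ?thesis
    by (simp only: sum_subtractf sum_distrib_right[symmetric] power2_eq_square)
qed

section \<open>Deviations of the empirical frequencies\<close>

locale iid_finite_range = prob_space P for P :: "'a measure" +
  fixes \<xi> :: "nat \<Rightarrow> 'a \<Rightarrow> real ^ 'd" and a :: "'k::finite \<Rightarrow> real ^ 'd"
  assumes indep: "indep_vars (\<lambda>_. borel) \<xi> {1..}"
    and ident: "\<And>n. n \<ge> 1 \<Longrightarrow> distr P borel (\<xi> n) = distr P borel (\<xi> 1)"
    and inj: "inj a"
    and range_eq: "\<And>n. n \<ge> 1 \<Longrightarrow> \<xi> n ` space P = range a"
begin

definition q :: "'k \<Rightarrow> real" where
  "q i = prob {\<omega>\<in>space P. \<xi> 1 \<omega> = a i}"

text \<open>At \<open>n = 0\<close> division by zero leaves the vector with coordinates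
  \<open>- q i\<close>; in the limit law it is multiplied by \<open>sqrt 0\<close>.\<close>

definition dev :: "nat \<Rightarrow> 'a \<Rightarrow> real ^ 'k" where
  "dev n \<omega> = (\<chi> i. (\<Sum>j=1..n. indicator {a i} (\<xi> j \<omega>)) / real n - q i)"

definition Q :: "real ^ 'k ^ 'k" where
  "Q = (\<chi> i j. if i = j then q i * (1 - q i) else - q i * q j)"

lemma rv[measurable]: "n \<ge> 1 \<Longrightarrow> random_variable borel (\<xi> n)"
  using indep by (simp add: indep_vars_def2)

text \<open>The index \<open>l\<close> is the same for all weights \<open>f\<close>, so sums with
  different weights can be evaluated together.\<close>

lemma indicator_sum:
  assumes "n \<ge> 1" "\<omega> \<in> space P"
  obtains l where "\<xi> n \<omega> = a l"
    "\<And>f. (\<Sum>i\<in>UNIV. f i * indicator {a i} (\<xi> n \<omega>)) = (f l :: real)"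
proof -
  obtain l where l: "\<xi> n \<omega> = a l"
    using range_eq[OF assms(1)] assms(2) by blast
  have "(\<Sum>i\<in>UNIV. f i * indicator {a i} (\<xi> n \<omega>)) = f l" for f :: "'k \<Rightarrow> real"
  proof -
    have "(\<Sum>i\<in>UNIV. f i * indicator {a i} (\<xi> n \<omega>)) = (\<Sum>i\<in>UNIV. if i = l then f i else 0)"
      using injD[OF inj] by (intro sum.cong) (auto simp: l indicator_def)
    then show ?thesis by simp
  qed
  with l that show thesis by blast
qed

lemma integrable_indicator: "n \<ge> 1 \<Longrightarrow> integrable P (\<lambda>\<omega>. indicator {a i} (\<xi> n \<omega>) :: real)"
  by (rule integrable_const_bound[where B=1]) (auto simp: indicator_def)

lemma expectation_indicator: "expectation (\<lambda>\<omega>. indicator {a i} (\<xi> 1 \<omega>)) = q i"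
proof -
  have "expectation (\<lambda>\<omega>. indicator {a i} (\<xi> 1 \<omega>)) =
      expectation (indicator {\<omega>\<in>space P. \<xi> 1 \<omega> = a i})"
    by (intro Bochner_Integration.integral_cong) (auto simp: indicator_def)
  also have "\<dots> = q i"
    unfolding q_def by (subst Bochner_Integration.integral_indicator) (auto intro!: arg_cong[where f=prob])
  finally show ?thesis .
qed

lemma expectation_sum_indicator:
  "expectation (\<lambda>\<omega>. \<Sum>i\<in>UNIV. f i * indicator {a i} (\<xi> 1 \<omega>)) = (\<Sum>i\<in>UNIV. f i * q i)"
  using integrable_indicator[of 1]
  by (subst Bochner_Integration.integral_sum) (simp_all add: expectation_indicator del: One_nat_def)

lemma q_nonneg: "q i \<ge> 0"
  by (simp add: q_def)

lemma sum_q: "(\<Sum>i\<in>UNIV. q i) = 1"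
proof -
  have "(\<Sum>i\<in>UNIV. q i) = expectation (\<lambda>\<omega>. \<Sum>i\<in>UNIV. 1 * indicator {a i} (\<xi> 1 \<omega>))"
    by (subst expectation_sum_indicator) simp
  also have "\<dots> = expectation (\<lambda>\<omega>. 1)"
  proof (rule Bochner_Integration.integral_cong[OF refl])
    fix \<omega> assume "\<omega> \<in> space P"
    then obtain l where "\<And>f. (\<Sum>i\<in>UNIV. f i * indicator {a i} (\<xi> 1 \<omega>)) = (f l :: real)"
      using indicator_sum[OF order_refl] by metis
    from this[of "\<lambda>_. 1"] show "(\<Sum>i\<in>UNIV. 1 * indicator {a i} (\<xi> 1 \<omega>)) = (1 :: real)" .
  qed
  finally show ?thesis by (simp add: prob_space)
qed

lemma iid_indicator:
  shows "indep_vars (\<lambda>_. borel) (\<lambda>n \<omega>. indicator {a i} (\<xi> n \<omega>) :: real) {1..}"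
    and "n \<ge> 1 \<Longrightarrow> distr P borel (\<lambda>\<omega>. indicator {a i} (\<xi> n \<omega>) :: real)
      = distr P borel (\<lambda>\<omega>. indicator {a i} (\<xi> 1 \<omega>))"
    and "AE \<omega> in P. (indicator {a i} (\<xi> 1 \<omega>) :: real) \<in> {0..1}"
proof -
  have g: "(indicator {a i} :: _ \<Rightarrow> real) \<in> borel_measurable borel" by measurable
  show "indep_vars (\<lambda>_. borel) (\<lambda>n \<omega>. indicator {a i} (\<xi> n \<omega>) :: real) {1..}"
    by (rule indep_vars_compose2[OF indep g])
  show "distr P borel (\<lambda>\<omega>. indicator {a i} (\<xi> n \<omega>) :: real)
      = distr P borel (\<lambda>\<omega>. indicator {a i} (\<xi> 1 \<omega>))" if "n \<ge> 1"
    by (rule distr_compose_eq[OF rv[OF that] rv[OF order_refl] ident[OF that] g])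
qed (auto simp: indicator_def)

lemma dev_measurable[measurable]: "random_variable borel (dev n)"
proof -
  have "(\<lambda>\<omega>. (\<Sum>j=1..n. indicator {a i} (\<xi> j \<omega>)) / real n - q i) \<in> borel_measurable P" for i
  proof (intro borel_measurable_diff borel_measurable_divide borel_measurable_sum borel_measurable_const)
    fix j assume "j \<in> {1..n}"
    then have "\<xi> j \<in> borel_measurable P" by (intro rv) simp
    then show "(\<lambda>\<omega>. indicator {a i} (\<xi> j \<omega>)) \<in> borel_measurable P"
      by measurable
  qed
  then show ?thesis
    unfolding dev_def
    by (subst borel_measurable_euclidean_space) (auto simp: Basis_vec_def inner_axis)
qed

lemma dev_AE_tendsto: "AE \<omega> in P. (\<lambda>n. dev n \<omega>) \<longlonglongrightarrow> 0"
proof -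
  have "AE \<omega> in P. \<forall>i\<in>UNIV. (\<lambda>n. (\<Sum>j=1..n. indicator {a i} (\<xi> j \<omega>)) / real n) \<longlonglongrightarrow> q i"
    using iid_average_AE_tendsto[OF iid_indicator]
    unfolding expectation_indicator by (subst AE_ball_countable) auto
  then show ?thesis
  proof (rule AE_mp, intro AE_I2 impI)
    fix \<omega> assume lim: "\<forall>i\<in>UNIV. (\<lambda>n. (\<Sum>j=1..n. indicator {a i} (\<xi> j \<omega>)) / real n) \<longlonglongrightarrow> q i"
    show "(\<lambda>n. dev n \<omega>) \<longlonglongrightarrow> 0"
    proof (rule vec_tendstoI)
      fix i
      show "(\<lambda>n. dev n \<omega> $ i) \<longlonglongrightarrow> 0 $ i"
        using tendsto_diff[OF lim[rule_format, of i] tendsto_const[of "q i"]] by (simp add: dev_def)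
    qed
  qed
qed

text \<open>Union bound over the coordinates, with Hoeffding's bound at distance
  \<open>L / (?k * sqrt (real n))\<close>: there \<open>n\<close> cancels from the exponent, leaving
  a quantity that tends to 0 as \<open>L\<close> grows.\<close>

lemma dev_tight:
  assumes "e > 0"
  shows "\<exists>L. \<forall>n. prob {\<omega>\<in>space P. L < norm (sqrt (real n) *\<^sub>R dev n \<omega>)} \<le> e"
proof -
  let ?k = "real CARD('k)"
  have k: "?k > 0" by simp
  have "((\<lambda>L. ?k * (2 * exp (- 2 * (L / ?k)\<^sup>2))) \<longlongrightarrow> 0) at_top"
    using k by real_asymp
  then have "\<forall>\<^sub>F L in at_top. ?k * (2 * exp (- 2 * (L / ?k)\<^sup>2)) < e"
    using assms by (rule order_tendstoD(2))
  then obtain L where L: "L \<ge> 0" "?k * (2 * exp (- 2 * (L / ?k)\<^sup>2)) < e"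
    by (auto simp: eventually_at_top_linorder) (meson linorder_linear order_trans)
  have "prob {\<omega>\<in>space P. L < norm (sqrt (real n) *\<^sub>R dev n \<omega>)} \<le> e" for n
  proof (cases "n = 0")
    case True
    then show ?thesis using L(1) assms by simp
  next
    case False
    \<comment> \<open>The threshold is \<open>L / sqrt (real n)\<close> shared equally among the
      \<open>?k\<close> coordinates: if none reaches its share, the l1 norm, and with it the
      Euclidean norm, is at most \<open>L / sqrt (real n)\<close>.\<close>
    define B where "B i = {\<omega>\<in>space P. \<bar>(\<Sum>j=1..n. indicator {a i} (\<xi> j \<omega>)) / real n - q i\<bar>
        \<ge> L / (?k * sqrt (real n))}" for i
    have B: "B i \<in> events" for i
    proof -
      have "(\<lambda>\<omega>. dev n \<omega> $ i) \<in> borel_measurable P"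
        by (rule measurable_compose[OF dev_measurable borel_measurable_continuous_onI])
          (intro continuous_intros)
      then show ?thesis unfolding B_def by (simp add: dev_def) 
    qed
    have "{\<omega>\<in>space P. L < norm (sqrt (real n) *\<^sub>R dev n \<omega>)} \<subseteq> (\<Union>i\<in>UNIV. B i)"
    proof safe
      fix \<omega> assume \<omega>: "\<omega> \<in> space P" "L < norm (sqrt (real n) *\<^sub>R dev n \<omega>)"
      show "\<omega> \<in> (\<Union>i\<in>UNIV. B i)"
      proof (rule ccontr)
        assume "\<omega> \<notin> (\<Union>i\<in>UNIV. B i)"
        then have "\<omega> \<notin> B i" for i by blast
        then have "\<bar>dev n \<omega> $ i\<bar> \<le> L / (?k * sqrt (real n))" for i
          using \<omega>(1) unfolding B_def by (simp add: dev_def not_le less_imp_le)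
        then have "(\<Sum>i\<in>UNIV. \<bar>dev n \<omega> $ i\<bar>) \<le> ?k * (L / (?k * sqrt (real n)))"
          by (intro sum_bounded_above) auto
        then have "norm (dev n \<omega>) \<le> L / sqrt (real n)"
          using norm_le_l1_cart[of "dev n \<omega>"] k by simp
        then show False
          using \<omega>(2) False by (simp add: field_simps)
      qed
    qed
    then have "prob {\<omega>\<in>space P. L < norm (sqrt (real n) *\<^sub>R dev n \<omega>)} \<le> prob (\<Union>i\<in>UNIV. B i)"
      using B by (intro finite_measure_mono) auto
    also have "\<dots> \<le> (\<Sum>i\<in>UNIV. prob (B i))"
      using B by (intro finite_measure_subadditive_finite) auto
    also have "\<dots> \<le> ?k * (2 * exp (- 2 * real n * (L / (?k * sqrt (real n)))\<^sup>2))"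
    proof (rule sum_bounded_above)
      fix i
      show "prob (B i) \<le> 2 * exp (- 2 * real n * (L / (?k * sqrt (real n)))\<^sup>2)"
        using iid_deviation_bound[OF iid_indicator, of "L / (?k * sqrt (real n))" n i] L(1) False
        unfolding expectation_indicator B_def by simp
    qed
    also have "- 2 * real n * (L / (?k * sqrt (real n)))\<^sup>2 = - 2 * (L / ?k)\<^sup>2"
      using False by (simp add: power_divide power_mult_distrib)
    also have "?k * (2 * exp \<dots>) \<le> e"
      using L(2) by simp
    finally show ?thesis .
  qed
  then show ?thesis by blast
qed

text \<open>The projection of the scaled deviation on \<open>t\<close> is a normalised sum of
  centred independent variables, each equal to \<open>t $ l - c\<close> when \<open>\<xi> j\<close>
  takes the value \<open>a l\<close>.\<close>

lemma dev_char_tendsto: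
  "(\<lambda>n. CLINT \<omega>|P. iexp (t \<bullet> (sqrt (real n) *\<^sub>R dev n \<omega>)))
    \<longlonglongrightarrow> of_real (exp (- (t \<bullet> (Q *v t)) / 2))"
proof -
  define c where "c = (\<Sum>i\<in>UNIV. t $ i * q i)"
  define g where "g y = (\<Sum>i\<in>UNIV. t $ i * indicator {a i} y) - c" for y
  define X where "X n \<omega> = g (\<xi> n \<omega>)" for n \<omega>
  have g[measurable]: "g \<in> borel_measurable borel"
    unfolding g_def by measurable
  \<comment> \<open>Exactly one indicator is 1, so squaring acts on the weights alone and the second
    moment is again a weighted sum of the \<open>q i\<close>.\<close>
  have Xsq: "(X 1 \<omega>)\<^sup>2 = (\<Sum>i\<in>UNIV. (t $ i - c)\<^sup>2 * indicator {a i} (\<xi> 1 \<omega>))"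
    if \<omega>: "\<omega> \<in> space P" for \<omega>
  proof -
    obtain l where l: "\<And>f. (\<Sum>i\<in>UNIV. f i * indicator {a i} (\<xi> 1 \<omega>)) = (f l :: real)"
      using indicator_sum[OF order_refl \<omega>] by metis
    show ?thesis by (simp only: X_def g_def l)
  qed
  have "(\<lambda>n. CLINT \<omega>|P. iexp ((\<Sum>j=1..n. X j \<omega>) / sqrt (real n)))
    \<longlonglongrightarrow> of_real (exp (- expectation (\<lambda>\<omega>. (X 1 \<omega>)\<^sup>2) / 2))"
  proof (rule iid_char_tendsto)
    show "indep_vars (\<lambda>_. borel) X {1..}"
      unfolding X_def by (rule indep_vars_compose2[OF indep g])
    show "distr P borel (X n) = distr P borel (X 1)" if "n \<ge> 1" for n
      unfolding X_def
      by (rule distr_compose_eq[OF rv[OF that] rv[OF order_refl] ident[OF that] g])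
    show "integrable P (\<lambda>\<omega>. (X 1 \<omega>)\<^sup>2)"
      by (subst Bochner_Integration.integrable_cong[OF refl Xsq], assumption)
        (intro Bochner_Integration.integrable_sum integrable_mult_right integrable_indicator order_refl)+
    have int: "integrable P (\<lambda>\<omega>. \<Sum>i\<in>UNIV. t $ i * indicator {a i} (\<xi> 1 \<omega>))"
      by (intro Bochner_Integration.integrable_sum integrable_mult_right integrable_indicator order_refl)
    have "expectation (X 1) = expectation (\<lambda>\<omega>. \<Sum>i\<in>UNIV. t $ i * indicator {a i} (\<xi> 1 \<omega>)) - c"
      unfolding X_def g_def Bochner_Integration.integral_diff[OF int integrable_const]
      by (simp add: prob_space)
    then show "expectation (X 1) = 0"
      by (simp only: expectation_sum_indicator c_def diff_self)
  qed
  moreover have "expectation (\<lambda>\<omega>. (X 1 \<omega>)\<^sup>2) = t \<bullet> (Q *v t)"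
  proof -
    have "expectation (\<lambda>\<omega>. (X 1 \<omega>)\<^sup>2) = (\<Sum>i\<in>UNIV. (t $ i - c)\<^sup>2 * q i)"
      by (subst Bochner_Integration.integral_cong[OF refl Xsq])
        (assumption | rule expectation_sum_indicator)+
    also have "\<dots> = (\<Sum>i\<in>UNIV. q i * (t $ i)\<^sup>2 - 2 * c * (t $ i * q i) + c\<^sup>2 * q i)"
      by (intro sum.cong) (auto simp: power2_eq_square algebra_simps)
    also have "\<dots> = (\<Sum>i\<in>UNIV. q i * (t $ i)\<^sup>2) - 2 * c * c + c\<^sup>2 * (\<Sum>i\<in>UNIV. q i)"
      by (simp add: sum.distrib sum_subtractf sum_distrib_left[symmetric] c_def)
    also have "\<dots> = t \<bullet> (Q *v t)"
      unfolding Q_def multinomial_covariance_quadratic_form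
      by (simp add: sum_q c_def power2_eq_square mult.commute)
    finally show ?thesis .
  qed
  moreover have "(\<Sum>j=1..n. X j \<omega>) / sqrt (real n) = t \<bullet> (sqrt (real n) *\<^sub>R dev n \<omega>)" for n \<omega>
  \<comment> \<open>For \<open>n = 0\<close> both sides are 0 by the conventions for division by
    zero and \<open>sqrt 0\<close>.\<close>
  proof (cases "n = 0")
    case False
    define S :: "'k \<Rightarrow> real" where "S i = (\<Sum>j=1..n. indicator {a i} (\<xi> j \<omega>))" for i
    have "(\<Sum>j=1..n. X j \<omega>) = (\<Sum>j=1..n. \<Sum>i\<in>UNIV. t $ i * indicator {a i} (\<xi> j \<omega>)) - real n * c"
      by (simp only: X_def g_def sum_subtractf sum_constant card_atLeastAtMost) simp
    also have "(\<Sum>j=1..n. \<Sum>i\<in>UNIV. t $ i * indicator {a i} (\<xi> j \<omega>)) = (\<Sum>i\<in>UNIV. t $ i * S i)"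
      unfolding S_def sum_distrib_left by (rule sum.swap)
    also have "\<dots> - real n * c = (\<Sum>i\<in>UNIV. real n * (t $ i * (S i / real n - q i)))"
      unfolding c_def sum_distrib_left sum_subtractf[symmetric]
      using False by (intro sum.cong) (simp_all add: field_simps)
    also have "\<dots> = real n * (t \<bullet> dev n \<omega>)"
      unfolding inner_vec_def dev_def S_def sum_distrib_left[symmetric] by simp
    finally have "(\<Sum>j=1..n. X j \<omega>) / sqrt (real n) = (real n / sqrt (real n)) * (t \<bullet> dev n \<omega>)"
      by simp
    then show ?thesis
      by (simp only: real_div_sqrt of_nat_0_le_iff inner_scaleR_right)
  qed simp
  ultimately show ?thesis by (simp only:)
qed

lemma ex_Q_factor: "\<exists>A :: real ^ 'k ^ 'k. A ** transpose A = Q"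
  unfolding Q_def by (rule multinomial_covariance_factor[OF q_nonneg sum_q])

lemma weak_conv_continuous_image_dev:
  assumes "continuous_on UNIV \<psi>"
  shows "weak_conv_m (\<lambda>n. distr P borel (\<lambda>\<omega>. \<psi> (sqrt (real n) *\<^sub>R dev n \<omega>)))
    (distr (multi_normal 0 Q) borel \<psi>)"
proof -
  define \<mu> where "\<mu> n = distr P borel (\<lambda>\<omega>. sqrt (real n) *\<^sub>R dev n \<omega>)" for n
  have "weak_conv_m (\<lambda>n. distr (\<mu> n) borel \<psi>) (distr (multi_normal 0 Q) borel \<psi>)"
  proof (rule tight_char_tendsto_imp_weak_conv_continuous_image[OF _ _ _ _ _ _ assms])
    show "prob_space (\<mu> n)" "sets (\<mu> n) = sets borel" for n
      unfolding \<mu>_def by (simp_all add: prob_space_distr)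
    show "prob_space (multi_normal 0 Q)" "sets (multi_normal 0 Q) = sets borel"
      by (rule multi_normal_prob_space sets_multi_normal)+
    show "(\<lambda>n. CLINT x|\<mu> n. iexp (t \<bullet> x)) \<longlonglongrightarrow> (CLINT x|multi_normal 0 Q. iexp (t \<bullet> x))" for t
    proof -
      \<comment> \<open>The characteristic function of a vector at \<open>t\<close> is that of its
        projection on \<open>t\<close> at 1.\<close>
      have "(CLINT x|multi_normal 0 Q. iexp (t \<bullet> x)) =
          char (distr (multi_normal 0 Q) borel (\<lambda>z. t \<bullet> z)) 1"
        unfolding char_def
        by (subst integral_distr) (simp_all add: measurable_cong_sets[OF sets_multi_normal refl])
      also have "\<dots> = of_real (exp (- (t \<bullet> (Q *v t)) / 2))"
        by (simp add: char_multi_normal[OF ex_Q_factor] exp_of_real[symmetric])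
      finally show ?thesis
        using dev_char_tendsto[of t] unfolding \<mu>_def by (simp add: integral_distr)
    qed
    show "\<exists>L. \<forall>n. measure (\<mu> n) {x. L < norm x} \<le> e" if "e > 0" for e
    proof -
      have "measure (\<mu> n) {x. L < norm x} = prob {\<omega>\<in>space P. L < norm (sqrt (real n) *\<^sub>R dev n \<omega>)}" for n L
        unfolding \<mu>_def
        by (subst measure_distr)
          (auto simp: vimage_def Int_def conj_commute intro!: borel_open open_Collect_less continuous_intros)
      then show ?thesis using dev_tight[OF that] by simp
    qed
  qed
  moreover have "distr (\<mu> n) borel \<psi> = distr P borel (\<lambda>\<omega>. \<psi> (sqrt (real n) *\<^sub>R dev n \<omega>))" for n
    unfolding \<mu>_def using borel_measurable_continuous_onI[OF assms]
    by (subst distr_distr) (auto simp: comp_def)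
  ultimately show ?thesis by simp
qed

end

theorem theorem3p1:
  fixes P :: "'a measure"
    and I :: "real set" and u v :: real
    and \<xi> :: "nat \<Rightarrow> 'a \<Rightarrow> real ^ 'd"
    and a :: "'k::finite \<Rightarrow> real ^ 'd"
    and q :: "'k \<Rightarrow> real"
    and m :: "'k \<Rightarrow> real ^ 'p \<Rightarrow> real"
    and M :: "nat \<Rightarrow> 'a \<Rightarrow> real ^ 'p \<Rightarrow> real"
    and \<kappa> :: "nat \<Rightarrow> 'a \<Rightarrow> real"
  assumes "prob_space P"
    and "u < v" and "I = {u..v}"
    and "prob_space.indep_vars P (\<lambda>_. borel) \<xi> {1..}"
    and "\<And>n. n \<ge> 1 \<Longrightarrow> distr P borel (\<xi> n) = distr P borel (\<xi> 1)"
    and "inj a"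
    and "\<And>n. n \<ge> 1 \<Longrightarrow> \<xi> n ` space P = range a"
    and "\<And>i. q i = measure P {\<omega>\<in>space P. \<xi> 1 \<omega> = a i}"
    and "\<And>i. 0 < q i \<and> q i < 1"
    and "\<And>i. m i \<in> means I"
    and "M = (\<lambda>n \<omega>. \<lambda>x\<in>cube I. \<Sum>i\<in>UNIV. m i x * indicator {a i} (\<xi> n \<omega>))"
    and "\<kappa> = (\<lambda>n \<omega>. SUP x\<in>cube I. \<bar>(1 / real n) * (\<Sum>j=1..n. M j \<omega> x) - expectation_cont P I (M 1) x\<bar>)"
  shows "(\<forall>n\<ge>1. random_mean P I (\<xi> n) (M n)) \<and>
    measure P {\<omega>\<in>space P. (\<lambda>n. \<kappa> n \<omega>) \<longlonglongrightarrow> 0} = 1 \<and>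
    has_expectation_cont P I (M 1) (expectation_cont P I (M 1)) \<and>
    (\<forall>x\<in>cube I. expectation_cont P I (M 1) x
        = (\<Sum>i\<in>UNIV. m i x * measure P {\<omega>\<in>space P. \<xi> 1 \<omega> = a i})) \<and>
    weak_conv_m (\<lambda>n. distr P borel (\<lambda>\<omega>. sqrt (real n) * \<kappa> n \<omega>))
      (distr (multi_normal 0 (\<chi> i j. if i = j then q i * (1 - q i) else - q i * q j)) borel
         (\<lambda>z. SUP x\<in>cube I. \<bar>z \<bullet> (\<chi> i. m i x)\<bar>))"
proof -
  interpret iid_finite_range P \<xi> a
    using assms(1,4-7) by (intro iid_finite_range.intro iid_finite_range_axioms.intro)
  have q_eq: "q = iid_finite_range.q P \<xi> a"
    using assms(8) by (simp add: q_def fun_eq_iff)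
  have rm: "random_mean P I (\<xi> n) (M n)" "simple_function P (M n)"
    "M n \<in> space P \<rightarrow> mspace (cont_space I)" if "n \<ge> 1" for n
    unfolding assms(11)
    by (rule random_mean_finite_range[OF assms(1) rv[OF that] _ assms(6,3,2,10)];
      simp add: assms(7)[OF that])+
  have compact: "compact (cube I :: (real ^ 'p) set)"
    unfolding assms(3) cube_Icc by simp
  have fin: "finite_measure P" by (rule finite_measure_axioms)
  have E: "expectation_cont P I (M 1) = simple_integral_cont P I (M 1)"
    by (rule expectation_cont_simple[OF fin compact rm(2,3)]) simp_all
  have Ex: "expectation_cont P I (M 1) x = (\<Sum>i\<in>UNIV. m i x * q i)" if x: "x \<in> cube I" for x
  proof -
    have "expectation_cont P I (M 1) x = (\<integral>\<omega>. M 1 \<omega> x \<partial>P)"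
      unfolding E by (rule simple_integral_cont_eq_integral(2)[OF fin rm(2) x]) simp
    also have "\<dots> = (\<integral>\<omega>. (\<Sum>i\<in>UNIV. m i x * indicator {a i} (\<xi> 1 \<omega>)) \<partial>P)"
      using x by (simp add: assms(11))
    finally show ?thesis
      by (simp only: expectation_sum_indicator q_eq)
  qed
  define mv :: "real ^ 'p \<Rightarrow> real ^ 'k" where "mv x = (\<chi> i. m i x)" for x
  define \<psi> where "\<psi> z = (SUP x\<in>cube I. \<bar>z \<bullet> mv x\<bar>)" for z
  have ne: "cube I \<noteq> ({} :: (real ^ 'p) set)"
  proof -
    have "(\<chi> i. u) \<in> cube I" using assms(2,3) by (simp add: cube_def)
    then show ?thesis by blast
  qed
  have "compact (mv ` cube I)"
  proof (rule compact_continuous_image[OF _ compact])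
    have "continuous_on (cube I) (m i)" for i
      using assms(10)[of i] mspace_cont_space[OF compact, of "m i"] unfolding means_def by blast
    then show "continuous_on (cube I) mv"
      unfolding mv_def by (intro continuous_on_vec_lambda)
  qed
  then have bounded: "bounded (mv ` cube I)"
    by (rule compact_imp_bounded)
  have \<psi>_cont: "continuous_on UNIV \<psi>"
    unfolding \<psi>_def[abs_def] by (rule continuous_SUP_abs_inner[OF ne bounded])
  have \<psi>_scale: "\<psi> (c *\<^sub>R z) = c * \<psi> z" if "c \<ge> 0" for c z
    using SUP_mult_left_nonneg[OF ne bdd_above_abs_inner[OF bounded, of z] that] that
    by (simp add: \<psi>_def abs_mult)
  \<comment> \<open>Interchanging the two finite sums gives an identity that holds for every
    \<open>\<omega>\<close> and every \<open>n\<close>, so \<open>\<kappa>\<close> inherits its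
    measurability from \<open>dev\<close>.\<close>
  have \<kappa>: "\<kappa> n \<omega> = \<psi> (dev n \<omega>)" for n \<omega>
  proof -
    have "1 / real n * (\<Sum>j=1..n. M j \<omega> x) - expectation_cont P I (M 1) x = dev n \<omega> \<bullet> mv x"
      if x: "x \<in> cube I" for x
    proof -
      have "(\<Sum>j=1..n. M j \<omega> x) = (\<Sum>j=1..n. \<Sum>i\<in>UNIV. m i x * indicator {a i} (\<xi> j \<omega>))"
        using x by (simp add: assms(11))
      also have "\<dots> = (\<Sum>i\<in>UNIV. m i x * (\<Sum>j=1..n. indicator {a i} (\<xi> j \<omega>)))"
        unfolding sum_distrib_left by (rule sum.swap)
      finally have "1 / real n * (\<Sum>j=1..n. M j \<omega> x) - expectation_cont P I (M 1) x
        = (\<Sum>i\<in>UNIV. 1 / real n * (m i x * (\<Sum>j=1..n. indicator {a i} (\<xi> j \<omega>))) - m i x * q i)"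
        by (simp only: Ex[OF x] sum_subtractf sum_distrib_left)
      also have "\<dots> = dev n \<omega> \<bullet> mv x"
        unfolding inner_vec_def dev_def mv_def q_eq by (intro sum.cong) (simp_all add: algebra_simps)
      finally show ?thesis .
    qed
    then show ?thesis
      unfolding assms(12) \<psi>_def by (intro SUP_cong) simp_all
  qed
  have \<kappa>_meas: "\<kappa> n \<in> borel_measurable P" for n
    unfolding \<kappa>[abs_def]
    by (rule measurable_compose[OF dev_measurable borel_measurable_continuous_onI[OF \<psi>_cont]])
  have "\<psi> 0 = 0"
    \<comment> \<open>Homogeneity with the factor 0.\<close>
    using \<psi>_scale[of 0 0] by simp
  have "AE \<omega> in P. (\<lambda>n. \<kappa> n \<omega>) \<longlonglongrightarrow> 0"
    using dev_AE_tendsto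
  proof (rule AE_mp, intro AE_I2 impI)
    fix \<omega> assume "(\<lambda>n. dev n \<omega>) \<longlonglongrightarrow> 0"
    then have "(\<lambda>n. \<psi> (dev n \<omega>)) \<longlonglongrightarrow> \<psi> 0"
      using continuous_on_tendsto_compose[OF \<psi>_cont] by simp
    then show "(\<lambda>n. \<kappa> n \<omega>) \<longlonglongrightarrow> 0"
      by (simp add: \<kappa> \<open>\<psi> 0 = 0\<close>)
  qed
  moreover have "{\<omega>\<in>space P. (\<lambda>n. \<kappa> n \<omega>) \<longlonglongrightarrow> 0} \<in> events"
    using \<kappa>_meas by measurable
  ultimately have lln: "prob {\<omega>\<in>space P. (\<lambda>n. \<kappa> n \<omega>) \<longlonglongrightarrow> 0} = 1"
    by (subst prob_Collect_eq_1) auto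
  have clt: "weak_conv_m (\<lambda>n. distr P borel (\<lambda>\<omega>. sqrt (real n) * \<kappa> n \<omega>))
      (distr (multi_normal 0 Q) borel \<psi>)"
    using weak_conv_continuous_image_dev[OF \<psi>_cont] by (simp add: \<kappa> \<psi>_scale)
  have "has_expectation_cont P I (M 1) (expectation_cont P I (M 1))"
    unfolding E by (rule has_expectation_cont_simple[OF compact rm(2,3)]) simp_all
  with rm(1) lln clt Ex show ?thesis
    unfolding assms(8)[symmetric] Q_def q_eq[symmetric] \<psi>_def[abs_def] mv_def by blast
qed

end
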